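(* Given $m$ strings $s_1,\dots,s_m$, each of length $n$, $q$ sets $S_1,\dots,S_q\subseteq[n]$ and a parameter $0\le d\le n$, there is an algorithm that computes a common alignment $\sigma_n$ of $s_1,\dots,s_m$ such that $\sum_{k\in[m]}|\bar{\sigma}_n(s_k)|\le dm$ and $|\bigcup_{j\in[q]}(\bar{\sigma}_n(s_1)\cap S_j)|$ is minimized (among such alignments), in time $\tilde{O}(2^m m n^{m+1})$.
   Context: A common alignment (common subsequence) $\sigma$ of $s_1,\dots,s_m$ is a sequence together with an embedding of it as a subsequence into each $s_j$; $\sigma(s_j)\subseteq[n]$ denotes the set of indices of characters of $s_j$ aligned by the embedding and $\bar{\sigma}(s_j)=[n]\setminus\sigma(s_j)$ the set of unaligned indices. $\tilde{O}$ hides polylogarithmic factors.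
   Formalization: The sets are given by listing, for each index i, all j with i in S_j (with offsets), since a bound free of q is impossible if the q sets are read one by one; if no common alignment meets the budget dm, the algorithm reports this; m is at least 1 and the time bound is for n at least 1. *)

theory Defs
  imports Complex_Main
begin

section \<open>Common alignments\<close>

text \<open>
  Indices are 0-based: the index set \<open>[n]\<close> is \<open>{..<n}\<close>, and \<open>s\<^sub>1, \<dots>, s\<^sub>m\<close> are
  \<open>ss ! 0, \<dots>, ss ! (m - 1)\<close>. An embedding is given by the increasing list of the positions
  that it hits.
\<close>

definition embeds :: "'a list \<Rightarrow> nat list \<Rightarrow> 'a list \<Rightarrow> bool" where
  "embeds \<tau> e s \<longleftrightarrow> length e = length \<tau> \<and> sorted_wrt (<) e \<and> set e \<subseteq> {..<length s} \<and>
     (\<forall>t<length \<tau>. s ! (e ! t) = \<tau> ! t)"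

type_synonym 'a alignment = "'a list \<times> nat list list"

definition common_alignment :: "'a list list \<Rightarrow> 'a alignment \<Rightarrow> bool" where
  "common_alignment ss \<sigma> \<longleftrightarrow> length (snd \<sigma>) = length ss \<and>
     (\<forall>k<length ss. embeds (fst \<sigma>) (snd \<sigma> ! k) (ss ! k))"

definition aligned :: "'a alignment \<Rightarrow> nat \<Rightarrow> nat set" where
  "aligned \<sigma> k = set (snd \<sigma> ! k)"

definition unaligned :: "nat \<Rightarrow> 'a alignment \<Rightarrow> nat \<Rightarrow> nat set" where
  "unaligned n \<sigma> k = {..<n} - aligned \<sigma> k"

definition feasible :: "'a list list \<Rightarrow> nat \<Rightarrow> nat \<Rightarrow> 'a alignment \<Rightarrow> bool" where
  "feasible ss n d \<sigma> \<longleftrightarrow> common_alignment ss \<sigma> \<and>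
     (\<Sum>k<length ss. card (unaligned n \<sigma> k)) \<le> d * length ss"

definition objective :: "nat \<Rightarrow> nat set list \<Rightarrow> 'a alignment \<Rightarrow> nat" where
  "objective n Ss \<sigma> = card (\<Union>j<length Ss. unaligned n \<sigma> 0 \<inter> Ss ! j)"

text \<open>
  The value \<open>None\<close> reports that no common alignment meets the budget, so that there is nothing
  to minimize over.
\<close>

definition solution ::
  "'a list list \<Rightarrow> nat \<Rightarrow> nat set list \<Rightarrow> nat \<Rightarrow> 'a alignment option \<Rightarrow> bool" where
  "solution ss n Ss d out \<longleftrightarrow>
     (case out of
        None \<Rightarrow> \<not> (\<exists>\<sigma>. feasible ss n d \<sigma>)
      | Some \<sigma> \<Rightarrow> is_arg_min (objective n Ss) (feasible ss n d) \<sigma>)"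


section \<open>Word RAM programs\<close>

text \<open>
  Structured programs over scalar variables and arrays, both named by natural numbers. Any single
  program mentions only finitely many of them. The machine has \<open>w\<close>-bit words: every computed value,
  hence also every array index, is reduced modulo \<open>2 ^ w\<close>. Every operator, memory access, literal
  and control step has unit cost.
\<close>

datatype binop = Add | Sub | Mul | Div | Mod | Less | Equal

fun apply_binop :: "binop \<Rightarrow> nat \<Rightarrow> nat \<Rightarrow> nat" where
  "apply_binop Add x y = x + y"
| "apply_binop Sub x y = x - y"
| "apply_binop Mul x y = x * y"
| "apply_binop Div x y = x div y"
| "apply_binop Mod x y = x mod y"
| "apply_binop Less x y = of_bool (x < y)"
| "apply_binop Equal x y = of_bool (x = y)"

datatype exp = Lit nat | Var nat | Load nat exp | Bin binop exp exp

record state =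
  vars :: "nat \<Rightarrow> nat"
  arrs :: "nat \<Rightarrow> nat \<Rightarrow> nat"

fun eval :: "nat \<Rightarrow> state \<Rightarrow> exp \<Rightarrow> nat" where
  "eval w s (Lit c) = c mod 2 ^ w"
| "eval w s (Var x) = vars s x"
| "eval w s (Load a e) = arrs s a (eval w s e)"
| "eval w s (Bin f e1 e2) = apply_binop f (eval w s e1) (eval w s e2) mod 2 ^ w"

fun exp_cost :: "exp \<Rightarrow> nat" where
  "exp_cost (Lit c) = 1"
| "exp_cost (Var x) = 1"
| "exp_cost (Load a e) = 1 + exp_cost e"
| "exp_cost (Bin f e1 e2) = 1 + exp_cost e1 + exp_cost e2"

datatype com =
    Skip
  | Assign nat exp
  | Store nat exp exp
  | Seq com com
  | If exp com com
  | While exp com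

text \<open>\<open>exec w c s t s'\<close>: from \<open>s\<close>, the program \<open>c\<close> halts in \<open>s'\<close> after exactly \<open>t\<close> steps.\<close>

inductive exec :: "nat \<Rightarrow> com \<Rightarrow> state \<Rightarrow> nat \<Rightarrow> state \<Rightarrow> bool" for w :: nat where
  Skip: "exec w Skip s 1 s"
| Assign: "exec w (Assign x e) s (1 + exp_cost e) (s\<lparr>vars := (vars s)(x := eval w s e)\<rparr>)"
| Store: "exec w (Store a i e) s (1 + exp_cost i + exp_cost e)
    (s\<lparr>arrs := (arrs s)(a := (arrs s a)(eval w s i := eval w s e))\<rparr>)"
| Seq: "exec w c1 s t1 s' \<Longrightarrow> exec w c2 s' t2 s'' \<Longrightarrow> exec w (Seq c1 c2) s (t1 + t2) s''"
| IfTrue: "eval w s b \<noteq> 0 \<Longrightarrow> exec w c1 s t s' \<Longrightarrow>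
    exec w (If b c1 c2) s (1 + exp_cost b + t) s'"
| IfFalse: "eval w s b = 0 \<Longrightarrow> exec w c2 s t s' \<Longrightarrow>
    exec w (If b c1 c2) s (1 + exp_cost b + t) s'"
| WhileFalse: "eval w s b = 0 \<Longrightarrow> exec w (While b c) s (1 + exp_cost b) s"
| WhileTrue: "eval w s b \<noteq> 0 \<Longrightarrow> exec w c s t1 s' \<Longrightarrow> exec w (While b c) s' t2 s'' \<Longrightarrow>
    exec w (While b c) s (1 + exp_cost b + t1 + t2) s''"

inductive_cases exec_SkipE: "exec w Skip s t s'"
inductive_cases exec_AssignE: "exec w (Assign x e) s t s'"
inductive_cases exec_StoreE: "exec w (Store a i e) s t s'"
inductive_cases exec_SeqE: "exec w (Seq c1 c2) s t s'"
inductive_cases exec_IfE: "exec w (If b c1 c2) s t s'"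
inductive_cases exec_WhileE: "exec w (While b c) s t s'"

lemma exec_deterministic:
  "exec w c s t s' \<Longrightarrow> exec w c s u r \<Longrightarrow> u = t \<and> r = s'"
proof (induction arbitrary: u r rule: exec.induct)
  case (Skip s)
  then show ?case by (auto elim: exec_SkipE)
next
  case (Assign x e s)
  then show ?case by (auto elim: exec_AssignE)
next
  case (Store a i e s)
  then show ?case by (auto elim: exec_StoreE)
next
  case (Seq c1 s t1 s' c2 t2 s'')
  from Seq.prems obtain u1 r1 u2 where
    "u = u1 + u2" "exec w c1 s u1 r1" "exec w c2 r1 u2 r" by (rule exec_SeqE)
  then show ?case using Seq.IH(1)[of u1 r1] Seq.IH(2)[of u2 r] by simp
next
  case (IfTrue s b c1 t s' c2)
  from IfTrue.prems IfTrue.hyps(1) obtain u1 where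
    "u = 1 + exp_cost b + u1" "exec w c1 s u1 r" by (elim exec_IfE) simp_all
  then show ?case using IfTrue.IH[of u1 r] by simp
next
  case (IfFalse s b c2 t s' c1)
  from IfFalse.prems IfFalse.hyps(1) obtain u1 where
    "u = 1 + exp_cost b + u1" "exec w c2 s u1 r" by (elim exec_IfE) simp_all
  then show ?case using IfFalse.IH[of u1 r] by simp
next
  case (WhileFalse s b c)
  from WhileFalse.prems show ?case by (rule exec_WhileE) (use WhileFalse.hyps in simp_all)
next
  case (WhileTrue s b c t1 s' t2 s'')
  from WhileTrue.prems obtain u1 r1 u2 where
    "u = 1 + exp_cost b + u1 + u2" "exec w c s u1 r1" "exec w (While b c) r1 u2 r"
    by (rule exec_WhileE) (use WhileTrue.hyps(1) in simp_all)
  then show ?case using WhileTrue.IH(1)[of u1 r1] WhileTrue.IH(2)[of u2 r] by simp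
qed


section \<open>Input and output conventions\<close>

text \<open>
  Symbols of the alphabet are words. The sets are presented by their incidence lists: for each
  index \<open>i < n\<close>, the list of all \<open>j\<close> with \<open>i \<in> S\<^sub>j\<close>, stored one after the other in array 2, where the
  list of \<open>i\<close> occupies the positions from \<open>offsets ! i\<close> up to, but excluding, \<open>offsets ! (i + 1)\<close>.
  (With one list or bit vector per set, no running time independent of \<open>q\<close> would be possible:
  finding the union of the \<open>S\<^sub>j\<close> already requires inspecting all \<open>q\<close> of them.)
\<close>

definition incidence :: "nat set list \<Rightarrow> nat \<Rightarrow> nat list" where
  "incidence Ss i = filter (\<lambda>j. i \<in> Ss ! j) [0..<length Ss]"

definition incidence_lists :: "nat \<Rightarrow> nat set list \<Rightarrow> nat list" where
  "incidence_lists n Ss = concat (map (incidence Ss) [0..<n])"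

definition offsets :: "nat \<Rightarrow> nat set list \<Rightarrow> nat list" where
  "offsets n Ss = map (\<lambda>i. length (incidence_lists i Ss)) [0..<Suc n]"

definition memory_of :: "nat list list \<Rightarrow> nat \<Rightarrow> nat \<Rightarrow> nat" where
  "memory_of xss a i = (if a < length xss \<and> i < length (xss ! a) then xss ! a ! i else 0)"

definition input_state :: "nat list list \<Rightarrow> nat \<Rightarrow> nat set list \<Rightarrow> nat \<Rightarrow> state" where
  "input_state ss n Ss d =
     \<lparr>vars = memory_of [[length ss, n, length Ss, d]] 0,
      arrs = memory_of [concat ss, offsets n Ss, incidence_lists n Ss]\<rparr>"

definition fits_words :: "nat \<Rightarrow> state \<Rightarrow> bool" where
  "fits_words w s \<longleftrightarrow> (\<forall>x. vars s x < 2 ^ w) \<and> (\<forall>a i. arrs s a i < 2 ^ w)"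

text \<open>
  Variable 4 tells whether an alignment was found, and variable 5 is its length. Array 3 holds its
  characters, and row \<open>k\<close> (with stride \<open>n\<close>) of array 4 the embedding into string \<open>k\<close>.
\<close>

definition output_of :: "nat \<Rightarrow> nat \<Rightarrow> state \<Rightarrow> nat alignment option" where
  "output_of m n s =
     (if vars s 4 = 0 then None
      else Some (map (arrs s 3) [0..<vars s 5],
                 map (\<lambda>k. map (\<lambda>t. arrs s 4 (k * n + t)) [0..<vars s 5]) [0..<m]))"

definition main_term :: "nat \<Rightarrow> nat \<Rightarrow> nat" where
  "main_term m n = 2 ^ m * m * n ^ (m + 1)"

text \<open>
  As usual for the word RAM, a word is assumed to be long enough to hold each word of the input and
  each address in a memory of size proportional to the time bound.
\<close>

definition word_size_ok :: "nat \<Rightarrow> nat \<Rightarrow> nat \<Rightarrow> nat \<Rightarrow> state \<Rightarrow> bool" where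
  "word_size_ok C w m n s \<longleftrightarrow> fits_words w s \<and> C * (1 + main_term m n) \<le> 2 ^ w"

end

theory Submission
  imports Defs
begin

text \<open>
  All embeddings of a common alignment of length \<open>L\<close> leave \<open>n - L\<close> indices unaligned, so the
  budget just says \<open>L \<ge> n - d\<close>, and minimizing the objective means maximizing the number of aligned
  indices of the first string that lie in some \<open>S\<^sub>j\<close> (call these indices marked; they are the ones
  with a nonempty incidence list). Dynamic programming over the \<open>(n + 1)\<^bsup>m+1\<^esup>\<close> pairs of an exact
  length and a vector of \<open>m\<close> prefix lengths solves this: a cell is reached by shortening one
  prefix, or by matching the last characters of all prefixes, which decrements every coordinate.
  Writing a cell as a number \<open>z\<close> in base \<open>n + 1\<close>, both moves subtract a fixed number from \<open>z\<close>, so a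
  single loop over \<open>z\<close> with \<open>O(m)\<close> work per cell fills the table. Predecessor pointers give the
  alignment, and \<open>(n + 1)\<^bsup>m+1\<^esup> \<le> 2\<^bsup>m+1\<^esup> n\<^bsup>m+1\<^esup>\<close> gives the time bound, without logarithmic factors.
\<close>

section \<open>The table of partial alignments\<close>

definition digit :: "nat \<Rightarrow> nat \<Rightarrow> nat \<Rightarrow> nat" where
  "digit B j z = z div B ^ j mod B"

lemma digit_0 [simp]: "digit B 0 z = z mod B"
  by (simp add: digit_def)

lemma power_le_of_digit_pos:
  assumes "0 < digit B k z"
  shows "B ^ k \<le> z"
proof (rule ccontr)
  assume "\<not> B ^ k \<le> z"
  then show False using assms by (simp add: digit_def)
qed

lemma digit_diff_power:
  assumes B: "0 < B" and pos: "0 < digit B k z"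
  shows "digit B j (z - B ^ k) = (if j = k then digit B k z - 1 else digit B j z)"
proof -
  define q where "q = z div B ^ k"
  define r where "r = z mod B ^ k"
  have z: "z = B ^ k * q + r" by (simp add: q_def r_def)
  have qpos: "0 < q mod B" using pos by (simp add: digit_def q_def)
  then have q1: "q = Suc (q - 1)" by (cases q) auto
  have z': "z - B ^ k = B ^ k * (q - 1) + r"
    using z by (subst (asm) q1) simp
  have r: "r < B ^ k" using B by (simp add: r_def)
  consider "j < k" | "j = k" | "j > k" by linarith
  then show ?thesis
  proof cases
    case 1
    then have "B ^ k = B ^ j * (B * B ^ (k - Suc j))"
      by (metis Suc_leI le_add_diff_inverse power_add power_Suc mult.assoc mult.commute)
    then have "z = B ^ j * (B * B ^ (k - Suc j) * q) + r"
      and "z - B ^ k = B ^ j * (B * B ^ (k - Suc j) * (q - 1)) + r"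
      using z z' by (simp_all add: mult.assoc)
    then have "z div B ^ j = r div B ^ j + B * (B ^ (k - Suc j) * q)"
      and "(z - B ^ k) div B ^ j = r div B ^ j + B * (B ^ (k - Suc j) * (q - 1))"
      using B by (simp_all add: mult.assoc)
    then show ?thesis using 1 by (simp add: digit_def)
  next
    case 2
    have "(z - B ^ k) div B ^ k = q - 1" using z' r B by simp
    moreover have "(q - 1) mod B = q mod B - 1"
      by (metis One_nat_def Suc_pred' mod_Suc q1 qpos diff_Suc_1 not_less_zero)
    ultimately show ?thesis using 2 by (simp add: digit_def q_def)
  next
    case 3
    then obtain i where j: "j = k + Suc i" using less_iff_Suc_add by auto
    have "(q - 1) div B = q div B"
      by (metis div_Suc q1 qpos not_less_zero mod_Suc)
    moreover have "(z - B ^ k) div B ^ k = q - 1" using z' r B by simp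
    moreover have "x div B ^ j = x div B ^ k div B div B ^ i" for x
      by (simp only: j power_add power_Suc div_mult2_eq)
    ultimately show ?thesis using 3 by (simp add: digit_def q_def)
  qed
qed

lemma digit_diff_repunit:
  assumes "0 < B" "\<forall>j<i. 0 < digit B j z"
  shows "(\<Sum>j<i. B ^ j) \<le> z \<and>
    (\<forall>j. digit B j (z - (\<Sum>j<i. B ^ j)) = (if j < i then digit B j z - 1 else digit B j z))"
  using assms(2)
proof (induction i)
  case (Suc i)
  let ?z = "z - (\<Sum>j<i. B ^ j)"
  have IH: "(\<Sum>j<i. B ^ j) \<le> z"
    "\<And>j. digit B j ?z = (if j < i then digit B j z - 1 else digit B j z)"
    using Suc by auto
  have pos: "0 < digit B i ?z" using IH(2) Suc.prems by simp
  have "z - (\<Sum>j<Suc i. B ^ j) = ?z - B ^ i" by simp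
  moreover have "B ^ i \<le> ?z" using power_le_of_digit_pos[OF pos] .
  ultimately show ?case
    using digit_diff_power[OF assms(1) pos] IH by (auto simp: less_Suc_eq)
qed simp

lemma digit_top:
  assumes "L < B" "k < m"
  shows "digit B (Suc k) (B ^ Suc m - B + L) = B - 1"
proof -
  have B: "0 < B" using assms by simp
  obtain i where m: "m = k + Suc i" using assms(2) less_iff_Suc_add by auto
  have "B ^ Suc m - B = B * (B ^ m - 1)" by (simp add: diff_mult_distrib2)
  then have 1: "(B ^ Suc m - B + L) div B = B ^ m - 1" using assms(1) by simp
  obtain a where a: "B ^ k = Suc a" using B by (metis gr0_implies_Suc zero_less_power)
  obtain b where b: "B ^ Suc i = Suc b" using B by (metis gr0_implies_Suc zero_less_power)
  obtain c where c: "B ^ i = Suc c" using B by (metis gr0_implies_Suc zero_less_power)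
  have "B ^ m = B ^ k * B ^ Suc i" by (simp only: m power_add)
  then have "B ^ m - 1 = B ^ k * b + a" unfolding b by (simp add: a)
  then have 2: "(B ^ m - 1) div B ^ k = b" by (intro div_nat_eqI) (simp_all add: a)
  obtain B' where B': "B = Suc B'" using B by (cases B) auto
  have "b = B * c + B'" using b c B' by simp
  then have "b mod B = B - 1" unfolding B' by (metis diff_Suc_1 lessI mod_less mod_mult_self4)
  then show ?thesis using 1 2 by (simp add: digit_def div_mult2_eq)
qed

lemma embeds_snoc:
  "embeds (\<tau> @ [a]) (e @ [x]) s \<longleftrightarrow>
    embeds \<tau> e s \<and> (\<forall>y\<in>set e. y < x) \<and> x < length s \<and> s ! x = a"
  by (auto simp: embeds_def sorted_wrt_append nth_append less_Suc_eq)

lemma nth_concat_uniform: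
  assumes "\<forall>s\<in>set ss. length s = n" "k < length ss" "i < n"
  shows "k * n + i < length (concat ss) \<and> concat ss ! (k * n + i) = ss ! k ! i"
  using assms
proof (induction ss arbitrary: k)
  case (Cons s ss)
  then show ?case by (cases k) (auto simp: nth_append)
qed simp

lemma common_alignment_length:
  assumes "common_alignment ss \<sigma>" "k < length ss"
  shows "length (snd \<sigma> ! k) = length (fst \<sigma>)" "distinct (snd \<sigma> ! k)"
    "set (snd \<sigma> ! k) \<subseteq> {..<length (ss ! k)}"
  using assms by (auto simp: common_alignment_def embeds_def strict_sorted_iff)

lemma mult_add_eq_iff:
  fixes n :: nat
  assumes "t < n" "u < n"
  shows "k * n + t = j * n + u \<longleftrightarrow> k = j \<and> t = u"
proof
  assume eq: "k * n + t = j * n + u"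
  then have "(k * n + t) div n = (j * n + u) div n" "(k * n + t) mod n = (j * n + u) mod n" by simp_all
  then show "k = j \<and> t = u" using assms by simp
qed simp

locale alignment_table =
  fixes m n d w :: nat and A Off :: "nat \<Rightarrow> nat"
  assumes m_pos: "1 \<le> m" and d_le: "d \<le> n" and m_less: "m < 2 ^ w"
    and mn_less: "m * n + n < 2 ^ w" and table_less: "2 * (n + 1) ^ (m + 1) < (2::nat) ^ w"
begin

definition B :: nat where "B = Suc n"
definition N :: nat where "N = B ^ Suc m"
abbreviation dig :: "nat \<Rightarrow> nat \<Rightarrow> nat" where "dig \<equiv> digit B"

lemma B_pos [simp]: "0 < B"
  by (simp add: B_def)

text \<open>
  The base-\<open>B\<close> digits of a cell \<open>z < N\<close> are the length of a partial alignment (digit 0) and the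
  lengths of the prefixes of the \<open>m\<close> strings that it may use (digits \<open>1, \<dots>, m\<close>).
\<close>

definition matched :: "nat \<Rightarrow> bool" where
  "matched z \<longleftrightarrow> 0 < z mod B \<and>
     (\<forall>k<m. 0 < dig (Suc k) z \<and> A (k * n + dig (Suc k) z - 1) = A (dig 1 z - 1))"

definition marked :: "nat \<Rightarrow> bool" where
  "marked i \<longleftrightarrow> Off i < Off (Suc i)"

definition diag :: "nat \<Rightarrow> nat" where
  "diag z = z - (\<Sum>j<Suc m. B ^ j)"

text \<open>
  Table entries are shifted by one: \<open>T z = 0\<close> means that no partial alignment has the shape \<open>z\<close>.
\<close>

definition dominates :: "(nat \<Rightarrow> nat) \<Rightarrow> nat \<Rightarrow> bool" where
  "dominates T z \<longleftrightarrow> (z mod B = 0 \<longrightarrow> 1 \<le> T z) \<and>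
     (\<forall>k<m. 0 < dig (Suc k) z \<longrightarrow> T (z - B ^ Suc k) \<le> T z) \<and>
     (matched z \<longrightarrow> 0 < T (diag z) \<longrightarrow> T (diag z) + of_bool (marked (dig 1 z - 1)) \<le> T z)"

definition justified :: "(nat \<Rightarrow> nat) \<Rightarrow> nat \<Rightarrow> nat \<Rightarrow> bool" where
  "justified T z y \<longleftrightarrow> (z mod B = 0 \<and> T z = 1) \<or>
     (\<exists>k<m. 0 < dig (Suc k) z \<and> y = z - B ^ Suc k \<and> T z = T y) \<or>
     (matched z \<and> y = diag z \<and> 0 < T y \<and> T z = T y + of_bool (marked (dig 1 z - 1)))"

definition good :: "(nat \<Rightarrow> nat) \<Rightarrow> (nat \<Rightarrow> nat) \<Rightarrow> nat \<Rightarrow> bool" where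
  "good T P z \<longleftrightarrow> dominates T z \<and> (0 < T z \<longrightarrow> justified T z (P z))"

lemma dig_skip:
  assumes "0 < dig (Suc k) z"
  shows "dig j (z - B ^ Suc k) = (if j = Suc k then dig (Suc k) z - 1 else dig j z)"
  using digit_diff_power[OF _ assms] by simp

lemma skip_mod:
  assumes "0 < dig (Suc k) z"
  shows "(z - B ^ Suc k) mod B = z mod B"
  using dig_skip[OF assms, of 0] by simp

lemma skip_less:
  assumes "0 < dig (Suc k) z"
  shows "z - B ^ Suc k < z"
proof -
  have "0 < B ^ Suc k" by simp
  then show ?thesis using power_le_of_digit_pos[OF assms] by linarith
qed

lemma matched_digits:
  assumes "matched z"
  shows "\<forall>j<Suc m. 0 < dig j z"
proof (intro allI impI)
  fix j assume "j < Suc m"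
  then show "0 < dig j z" using assms by (cases j) (auto simp: matched_def)
qed

lemma dig_diag:
  assumes "matched z" "j \<le> m"
  shows "dig j (diag z) = dig j z - 1"
  using digit_diff_repunit[OF _ matched_digits[OF assms(1)]] assms(2)
  by (simp add: diag_def less_Suc_eq_le)

lemma diag_mod:
  assumes "matched z"
  shows "diag z mod B = z mod B - 1"
  using dig_diag[OF assms, of 0] by simp

lemma diag_less:
  assumes "matched z"
  shows "diag z < z"
proof -
  have "(1::nat) \<le> (\<Sum>j<Suc m. B ^ j)" by (subst sum.lessThan_Suc_shift) simp
  moreover have "0 < z" using assms by (cases z) (auto simp: matched_def)
  ultimately show ?thesis by (simp add: diag_def del: sum.lessThan_Suc)
qed

lemma good_cong:
  assumes "\<And>x. x \<le> z \<Longrightarrow> T' x = T x" "P' z = P z" "good T P z"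
  shows "good T' P' z"
proof -
  have a: "T' (z - B ^ Suc k) = T (z - B ^ Suc k)" for k using assms(1) by simp
  have b: "T' (diag z) = T (diag z)" using assms(1) by (simp add: diag_def)
  have c: "T' z = T z" using assms(1) by simp
  have "justified T' z (P z)" if "justified T z (P z)"
    using that a b c unfolding justified_def by metis
  moreover have "dominates T' z" using assms(3) a b c unfolding good_def dominates_def by metis
  ultimately show ?thesis using assms c unfolding good_def by metis
qed

lemma table_bound:
  assumes "\<forall>y\<le>z. good T P y"
  shows "T z \<le> 1 + z mod B"
  using assms
proof (induction z rule: less_induct)
  case (less z)
  show ?case
  proof (cases "0 < T z")
    case True
    then have "justified T z (P z)" using less.prems by (simp add: good_def)
    then consider "z mod B = 0" "T z = 1"
      | k where "0 < dig (Suc k) z" "T z = T (z - B ^ Suc k)"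
      | "matched z" "T z = T (diag z) + of_bool (marked (dig 1 z - 1))"
      unfolding justified_def by metis
    then show ?thesis
    proof cases
      case 2
      then show ?thesis using less.IH[OF skip_less[OF 2(1)]] less.prems skip_mod[OF 2(1)] skip_less[OF 2(1)]
        by (metis less_imp_le order_trans)
    next
      case 3
      have "T (diag z) \<le> 1 + diag z mod B"
        using less.IH[OF diag_less[OF 3(1)]] less.prems diag_less[OF 3(1)] by simp
      moreover have "0 < z mod B" using 3(1) by (simp add: matched_def)
      ultimately show ?thesis using 3(2) diag_mod[OF 3(1)] by simp
    qed simp
  qed simp
qed

lemma table_optimal:
  assumes tab: "\<forall>z<N. good T P z" and len: "length ss = m" "\<forall>s\<in>set ss. length s = n"
    and A: "\<And>k i. k < m \<Longrightarrow> i < n \<Longrightarrow> A (k * n + i) = ss ! k ! i"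
  shows "z < N \<Longrightarrow> common_alignment ss (\<tau>, es) \<Longrightarrow> length \<tau> = z mod B \<Longrightarrow>
    (\<And>k x. k < m \<Longrightarrow> x \<in> set (es ! k) \<Longrightarrow> x < dig (Suc k) z) \<Longrightarrow>
    card {x \<in> set (es ! 0). marked x} < T z"
proof (induction z arbitrary: \<tau> es rule: less_induct)
  case (less z)
  have dom: "dominates T z" using tab less.prems(1) by (simp add: good_def)
  have lene: "length es = m" using less.prems(2) len by (simp add: common_alignment_def)
  have emb: "embeds \<tau> (es ! k) (ss ! k)" if "k < m" for k
    using less.prems(2) that len by (simp add: common_alignment_def)
  show ?case
  proof (cases \<tau> rule: rev_cases)
    case Nil
    then have "es ! 0 = []" using emb[of 0] m_pos by (simp add: embeds_def)
    then show ?thesis using dom Nil less.prems(3) by (simp add: dominates_def)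
  next
    case (snoc \<tau>' a)
    have split: "es ! k = butlast (es ! k) @ [last (es ! k)]" if "k < m" for k
      using emb[OF that] snoc by (cases "es ! k" rule: rev_cases) (auto simp: embeds_def)
    have last: "last (es ! k) \<in> set (es ! k)" if "k < m" for k
      using split[OF that] by (metis last_in_set snoc_eq_iff_butlast)
    have emb': "embeds \<tau>' (butlast (es ! k)) (ss ! k)"
      "\<forall>y\<in>set (butlast (es ! k)). y < last (es ! k)"
      "last (es ! k) < n" "ss ! k ! last (es ! k) = a" if "k < m" for k
      using emb[OF that] that len unfolding snoc by (subst (asm) split[OF that], simp add: embeds_snoc)+
    show ?thesis
    proof (cases "\<exists>k<m. Suc (last (es ! k)) < dig (Suc k) z")
      case True
      then obtain k where k: "k < m" "Suc (last (es ! k)) < dig (Suc k) z" by blast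
      then have pos: "0 < dig (Suc k) z" by simp
      have "card {x \<in> set (es ! 0). marked x} < T (z - B ^ Suc k)"
      proof (rule less.IH[OF skip_less[OF pos] _ less.prems(2)])
        show "z - B ^ Suc k < N" using less.prems(1) by linarith
        show "length \<tau> = (z - B ^ Suc k) mod B" using less.prems(3) skip_mod[OF pos] by simp
        fix j x assume j: "j < m" "x \<in> set (es ! j)"
        have "x \<le> last (es ! j)" using emb'(2)[OF j(1)] split[OF j(1)] j(2)
          by (metis Un_iff empty_iff empty_set insertE less_imp_le list.simps(15) order_refl set_append)
        then show "x < dig (Suc j) (z - B ^ Suc k)"
          using less.prems(4)[OF j] k dig_skip[OF pos, of "Suc j"] by auto
      qed
      also have "\<dots> \<le> T z" using dom k(1) pos by (simp add: dominates_def)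
      finally show ?thesis .
    next
      case False
      then have top: "dig (Suc k) z = Suc (last (es ! k))" if "k < m" for k
        using less.prems(4)[OF that last[OF that]] that by (metis Suc_lessI)
      have chr: "A (k * n + dig (Suc k) z - 1) = a" if "k < m" for k
        using top[OF that] emb'(3,4)[OF that] A[OF that] by simp
      have mat: "matched z" unfolding matched_def
        using less.prems(3) snoc top chr chr[of 0] m_pos by auto
      define es' where "es' = map butlast es"
      have "card {x \<in> set (es' ! 0). marked x} < T (diag z)"
      proof (rule less.IH[OF diag_less[OF mat]])
        show "diag z < N" using less.prems(1) diag_less[OF mat] by linarith
        show "common_alignment ss (\<tau>', es')"
          using emb'(1) lene len by (simp add: common_alignment_def es'_def)
        show "length \<tau>' = diag z mod B" using diag_mod[OF mat] less.prems(3) snoc by simp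
        fix k x assume "k < m" "x \<in> set (es' ! k)"
        then show "x < dig (Suc k) (diag z)"
          using emb'(2)[of k] top[of k] dig_diag[OF mat, of "Suc k"] lene by (simp add: es'_def)
      qed
      moreover have "T (diag z) + of_bool (marked (dig 1 z - 1)) \<le> T z"
        using dom mat calculation by (simp add: dominates_def)
      moreover have "card {x \<in> set (es ! 0). marked x}
          \<le> card {x \<in> set (es' ! 0). marked x} + of_bool (marked (last (es ! 0)))"
      proof -
        have "set (es ! 0) = insert (last (es ! 0)) (set (es' ! 0))"
          using split[of 0] m_pos lene unfolding es'_def
          by (metis Un_insert_right empty_set list.simps(15) nth_map set_append sup_bot.right_neutral
              less_le_trans zero_less_one)
        then have "{x \<in> set (es ! 0). marked x} \<subseteq>
            {x \<in> set (es' ! 0). marked x} \<union> (if marked (last (es ! 0)) then {last (es ! 0)} else {})"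
          by auto
        then have "card {x \<in> set (es ! 0). marked x} \<le> card ({x \<in> set (es' ! 0). marked x} \<union>
            (if marked (last (es ! 0)) then {last (es ! 0)} else {}))"
          by (intro card_mono) auto
        also have "\<dots> \<le> card {x \<in> set (es' ! 0). marked x} +
            card (if marked (last (es ! 0)) then {last (es ! 0)} else {})"
          by (rule card_Un_le)
        finally show ?thesis by (simp split: if_splits)
      qed
      ultimately show ?thesis using top[of 0] m_pos by simp
    qed
  qed
qed

end

section \<open>Timed execution\<close>

definition run :: "nat \<Rightarrow> com \<Rightarrow> state \<Rightarrow> (nat \<Rightarrow> state \<Rightarrow> bool) \<Rightarrow> bool" where
  "run w c s Q \<longleftrightarrow> (\<exists>t s'. exec w c s t s' \<and> Q t s')"

lemma run_mono:
  assumes "run w c s Q" "\<And>t s'. Q t s' \<Longrightarrow> R t s'"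
  shows "run w c s R"
  using assms unfolding run_def by blast

lemma run_SeqI:
  assumes "run w c1 s Q1" "\<And>t1 s1. Q1 t1 s1 \<Longrightarrow> run w c2 s1 (\<lambda>t2. Q (t1 + t2))"
  shows "run w (Seq c1 c2) s Q"
  using assms unfolding run_def by (blast intro: exec.Seq)

lemma run_Skip [simp]: "run w Skip s Q \<longleftrightarrow> Q 1 s"
  unfolding run_def by (metis exec.Skip exec_SkipE)

lemma run_Assign [simp]:
  "run w (Assign x e) s Q \<longleftrightarrow> Q (1 + exp_cost e) (s\<lparr>vars := (vars s)(x := eval w s e)\<rparr>)"
proof -
  have "exec w (Assign x e) s t s' \<longleftrightarrow>
      t = 1 + exp_cost e \<and> s' = s\<lparr>vars := (vars s)(x := eval w s e)\<rparr>" for t s'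
    using exec.Assign[of w x e s] by (auto elim: exec_AssignE)
  then show ?thesis by (simp add: run_def)
qed

lemma run_Store [simp]:
  "run w (Store a i e) s Q \<longleftrightarrow> Q (1 + exp_cost i + exp_cost e)
     (s\<lparr>arrs := (arrs s)(a := (arrs s a)(eval w s i := eval w s e))\<rparr>)"
proof -
  have "exec w (Store a i e) s t s' \<longleftrightarrow> t = 1 + exp_cost i + exp_cost e \<and>
      s' = s\<lparr>arrs := (arrs s)(a := (arrs s a)(eval w s i := eval w s e))\<rparr>" for t s'
    using exec.Store[of w a i e s] by (auto elim: exec_StoreE)
  then show ?thesis by (simp add: run_def)
qed

lemma run_Seq [simp]:
  "run w (Seq c1 c2) s Q \<longleftrightarrow> run w c1 s (\<lambda>t1 s1. run w c2 s1 (\<lambda>t2. Q (t1 + t2)))"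
  unfolding run_def by (blast intro: exec.Seq elim!: exec_SeqE)

lemma run_If [simp]:
  "run w (If b c1 c2) s Q \<longleftrightarrow>
     (if eval w s b \<noteq> 0 then run w c1 s (\<lambda>t. Q (1 + exp_cost b + t))
      else run w c2 s (\<lambda>t. Q (1 + exp_cost b + t)))"
proof (cases "eval w s b = 0")
  case True
  then have "exec w (If b c1 c2) s t s' \<longleftrightarrow> (\<exists>u. t = 1 + exp_cost b + u \<and> exec w c2 s u s')" for t s'
    using True exec.IfFalse[OF True, of c2 _ s' c1] by (auto elim: exec_IfE)
  then show ?thesis using True unfolding run_def by auto
next
  case False
  then have "exec w (If b c1 c2) s t s' \<longleftrightarrow> (\<exists>u. t = 1 + exp_cost b + u \<and> exec w c1 s u s')" for t s'
    using False exec.IfTrue[OF False, of c1 _ s' c2] by (auto elim: exec_IfE)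
  then show ?thesis using False unfolding run_def by auto
qed

lemma run_While:
  assumes "I s" and step: "\<And>s. I s \<Longrightarrow> eval w s b \<noteq> 0 \<Longrightarrow>
    run w c s (\<lambda>t s'. t \<le> K \<and> I s' \<and> \<mu> s' < (\<mu> s :: nat))"
  shows "run w (While b c) s
    (\<lambda>t s'. t \<le> \<mu> s * (1 + exp_cost b + K) + (1 + exp_cost b) \<and> I s' \<and> eval w s' b = 0)"
  using assms(1)
proof (induction "\<mu> s" arbitrary: s rule: less_induct)
  case less
  show ?case
  proof (cases "eval w s b = 0")
    case True
    then show ?thesis using less.prems exec.WhileFalse[OF True] unfolding run_def
      by (intro exI conjI) auto
  next
    case False
    then obtain t1 s1 where 1: "exec w c s t1 s1" "t1 \<le> K" "I s1" "\<mu> s1 < \<mu> s"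
      using step[OF less.prems False] unfolding run_def by blast
    obtain t2 s2 where 2: "exec w (While b c) s1 t2 s2" "I s2" "eval w s2 b = 0"
      "t2 \<le> \<mu> s1 * (1 + exp_cost b + K) + (1 + exp_cost b)"
      using less.hyps[OF 1(4,3)] unfolding run_def by blast
    have "Suc (\<mu> s1) * (1 + exp_cost b + K) \<le> \<mu> s * (1 + exp_cost b + K)"
      using 1(4) by (intro mult_right_mono) auto
    then have "1 + exp_cost b + t1 + t2 \<le> \<mu> s * (1 + exp_cost b + K) + (1 + exp_cost b)"
      using 1(2) 2(4) by simp
    then show ?thesis
      unfolding run_def using exec.WhileTrue[OF False 1(1) 2(1)] 2(2,3) by blast
  qed
qed

section \<open>The program\<close>

notation Seq (infixr ";;" 60)
notation Assign (infix "::=" 61)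

abbreviation (input) xM :: nat where "xM \<equiv> 0"
abbreviation (input) xN :: nat where "xN \<equiv> 1"
abbreviation (input) xD :: nat where "xD \<equiv> 3"
abbreviation (input) xFound :: nat where "xFound \<equiv> 4"
abbreviation (input) xLen :: nat where "xLen \<equiv> 5"
abbreviation (input) xBase :: nat where "xBase \<equiv> 6"
abbreviation (input) xSize :: nat where "xSize \<equiv> 7"
abbreviation (input) xZ :: nat where "xZ \<equiv> 8"
abbreviation (input) xK :: nat where "xK \<equiv> 9"
abbreviation (input) xPow :: nat where "xPow \<equiv> 10"
abbreviation (input) xY :: nat where "xY \<equiv> 11"
abbreviation (input) xBest :: nat where "xBest \<equiv> 12"
abbreviation (input) xOk :: nat where "xOk \<equiv> 13"
abbreviation (input) xDiag :: nat where "xDiag \<equiv> 14"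
abbreviation (input) xNext :: nat where "xNext \<equiv> 15"
abbreviation (input) xDigit :: nat where "xDigit \<equiv> 16"
abbreviation (input) xFirst :: nat where "xFirst \<equiv> 17"
abbreviation (input) xTmp :: nat where "xTmp \<equiv> 18"

abbreviation (input) aStrings :: nat where "aStrings \<equiv> 0"
abbreviation (input) aOffsets :: nat where "aOffsets \<equiv> 1"
abbreviation (input) aChars :: nat where "aChars \<equiv> 3"
abbreviation (input) aEmb :: nat where "aEmb \<equiv> 4"
abbreviation (input) aTable :: nat where "aTable \<equiv> 5"
abbreviation (input) aNext :: nat where "aNext \<equiv> 6"

abbreviation (input) increment :: "nat \<Rightarrow> com" where
  "increment x \<equiv> x ::= Bin Add (Var x) (Lit 1)"

definition size_body :: com where
  "size_body = (xSize ::= Bin Mul (Var xSize) (Var xBase) ;; increment xK)"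

definition compute_size :: com where
  "compute_size =
     (xBase ::= Bin Add (Var xN) (Lit 1) ;; xSize ::= Var xBase ;; xK ::= Lit 0 ;;
      While (Bin Less (Var xK) (Var xM)) size_body)"

definition skip_body :: com where
  "skip_body =
     (xDigit ::= Bin Mod (Var xY) (Var xBase) ;;
      If (Var xDigit)
        (If (Bin Less (Var xBest) (Load aTable (Bin Sub (Var xZ) (Var xPow))))
           (xBest ::= Load aTable (Bin Sub (Var xZ) (Var xPow)) ;;
            xNext ::= Bin Sub (Var xZ) (Var xPow))
           Skip ;;
         If (Bin Equal
              (Load aStrings (Bin Sub (Bin Add (Bin Mul (Var xK) (Var xN)) (Var xDigit)) (Lit 1)))
              (Load aStrings (Bin Sub (Var xFirst) (Lit 1))))
           Skip (xOk ::= Lit 0) ;;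
         xDiag ::= Bin Sub (Var xDiag) (Var xPow))
        (xOk ::= Lit 0) ;;
      xY ::= Bin Div (Var xY) (Var xBase) ;;
      xPow ::= Bin Mul (Var xPow) (Var xBase) ;;
      increment xK)"

definition match_step :: com where
  "match_step =
     If (Var xOk)
       (If (Load aTable (Var xDiag))
          (xTmp ::= Bin Add (Load aTable (Var xDiag))
             (Bin Less (Load aOffsets (Bin Sub (Var xFirst) (Lit 1)))
                (Load aOffsets (Var xFirst))) ;;
           If (Bin Less (Var xBest) (Var xTmp))
             (xBest ::= Var xTmp ;; xNext ::= Var xDiag) Skip)
          Skip)
       Skip"

definition cell_init :: com where
  "cell_init =
     (xY ::= Bin Div (Var xZ) (Var xBase) ;;
      xPow ::= Var xBase ;;
      xFirst ::= Bin Mod (Var xY) (Var xBase) ;;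
      xOk ::= Bin Mod (Var xZ) (Var xBase) ;;
      xBest ::= Bin Equal (Var xOk) (Lit 0) ;;
      xDiag ::= Bin Sub (Var xZ) (Lit 1) ;;
      xNext ::= Var xZ ;;
      xK ::= Lit 0)"

definition cell_store :: com where
  "cell_store =
     (Store aTable (Var xZ) (Var xBest) ;; Store aNext (Var xZ) (Var xNext) ;; increment xZ)"

definition cell_body :: com where
  "cell_body =
     (cell_init ;; While (Bin Less (Var xK) (Var xM)) skip_body ;; match_step ;; cell_store)"

definition fill_table :: com where
  "fill_table = (xZ ::= Lit 0 ;; While (Bin Less (Var xZ) (Var xSize)) cell_body)"

definition scan_body :: com where
  "scan_body =
     (If (Bin Less (Var xBest) (Load aTable (Var xZ)))
        (xBest ::= Load aTable (Var xZ) ;; xNext ::= Var xZ) Skip ;;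
      increment xZ)"

definition scan :: com where
  "scan =
     (xZ ::= Bin Sub (Bin Sub (Var xSize) (Lit 1)) (Var xD) ;; xBest ::= Lit 0 ;;
      While (Bin Less (Var xZ) (Var xSize)) scan_body)"

definition write_body :: com where
  "write_body =
     (Store aEmb (Bin Add (Bin Mul (Var xK) (Var xN)) (Var xTmp))
        (Bin Sub (Bin Mod (Var xY) (Var xBase)) (Lit 1)) ;;
      xY ::= Bin Div (Var xY) (Var xBase) ;;
      increment xK)"

text \<open>
  Slot \<open>L - 1\<close> of the output is rewritten at every cell of length \<open>L\<close> on the way back. The last
  write happens at the cell from which the length drops, and it is the correct one.
\<close>

definition trace_body :: com where
  "trace_body =
     (xTmp ::= Bin Sub (Bin Mod (Var xZ) (Var xBase)) (Lit 1) ;;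
      xY ::= Bin Div (Var xZ) (Var xBase) ;;
      Store aChars (Var xTmp)
        (Load aStrings (Bin Sub (Bin Mod (Var xY) (Var xBase)) (Lit 1))) ;;
      xK ::= Lit 0 ;;
      While (Bin Less (Var xK) (Var xM)) write_body ;;
      xZ ::= Load aNext (Var xZ))"

definition trace :: com where
  "trace =
     If (Var xBest)
       (xZ ::= Var xNext ;; xLen ::= Bin Mod (Var xZ) (Var xBase) ;;
        While (Bin Mod (Var xZ) (Var xBase)) trace_body ;; xFound ::= Lit 1)
       Skip"

definition aligner :: com where
  "aligner = (compute_size ;; fill_table ;; scan ;; trace)"

section \<open>Verification\<close>

context alignment_table
begin

lemma N_less: "2 * N < 2 ^ w" using table_less by (simp add: N_def B_def)

lemma power_le_N: "k \<le> Suc m \<Longrightarrow> B ^ k \<le> N"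
  unfolding N_def by (rule power_increasing) (auto simp: B_def)

lemma B_le_N: "B \<le> N" using power_le_N[of 1] by simp

lemma w_pos [simp]: "0 < w"
  using N_less B_le_N B_pos by (cases w) auto

lemma one_mod [simp]: "Suc 0 mod 2 ^ w = Suc 0"
  using N_less B_le_N B_pos by (intro mod_less) linarith

lemma of_bool_mod [simp]: "of_bool b mod 2 ^ w = (of_bool b :: nat)"
  by (cases b) simp_all

definition frame :: "(nat \<Rightarrow> nat) \<Rightarrow> (nat \<Rightarrow> nat) \<Rightarrow> state \<Rightarrow> bool" where
  "frame T P s \<longleftrightarrow> vars s xM = m \<and> vars s xN = n \<and> vars s xD = d \<and> vars s xFound = 0 \<and>
     vars s xBase = B \<and> vars s xSize = N \<and> arrs s aStrings = A \<and> arrs s aOffsets = Off \<and>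
     arrs s aTable = T \<and> arrs s aNext = P"

lemma run_compute_size:
  assumes "vars s xM = m" "vars s xN = n" "vars s xD = d" "vars s xFound = 0"
    "arrs s aStrings = A" "arrs s aOffsets = Off"
  shows "run w compute_size s (\<lambda>t s'. t \<le> 20 + 20 * m \<and> (\<exists>T P. frame T P s'))"
proof -
  define I where "I s' \<longleftrightarrow> vars s' xM = m \<and> vars s' xN = n \<and> vars s' xD = d \<and>
    vars s' xFound = 0 \<and> arrs s' aStrings = A \<and> arrs s' aOffsets = Off \<and> vars s' xBase = B \<and>
    vars s' xK \<le> m \<and> vars s' xSize = B ^ Suc (vars s' xK)" for s' :: state
  have loop: "run w (While (Bin Less (Var xK) (Var xM)) size_body) s0
    (\<lambda>t s'. t \<le> (m - vars s0 xK) * (1 + exp_cost (Bin Less (Var xK) (Var xM)) + 8)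
       + (1 + exp_cost (Bin Less (Var xK) (Var xM))) \<and>
       I s' \<and> eval w s' (Bin Less (Var xK) (Var xM)) = 0)" if "I s0" for s0
  proof (rule run_While[where I = I, OF that])
    fix s1 assume I: "I s1" and "eval w s1 (Bin Less (Var xK) (Var xM)) \<noteq> 0"
    then have k: "vars s1 xK < m" by (simp add: I_def)
    then have "B ^ Suc (Suc (vars s1 xK)) \<le> N" by (intro power_le_N) simp
    then have "B ^ Suc (Suc (vars s1 xK)) < 2 ^ w" using N_less by linarith
    then have "B * (B * B ^ vars s1 xK) < 2 ^ w" by simp
    moreover have "Suc (vars s1 xK) < 2 ^ w" using k m_less by linarith
    ultimately show "run w size_body s1 (\<lambda>t s'. t \<le> 8 \<and> I s' \<and> m - vars s' xK < m - vars s1 xK)"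
      using I k unfolding I_def by (simp add: size_body_def mult.commute mult.left_commute; linarith)
  qed
  have "Suc n < 2 ^ w" using N_less B_le_N by (simp add: B_def)
  then show ?thesis
    unfolding compute_size_def using assms
    apply simp
    apply (rule run_mono[OF loop])
     apply (auto simp: I_def B_def N_def frame_def)
    done
qed

definition prefix_matched :: "nat \<Rightarrow> nat \<Rightarrow> bool" where
  "prefix_matched z k \<longleftrightarrow> 0 < z mod B \<and>
     (\<forall>j<k. 0 < dig (Suc j) z \<and> A (j * n + dig (Suc j) z - 1) = A (dig 1 z - 1))"

definition candidate :: "(nat \<Rightarrow> nat) \<Rightarrow> nat \<Rightarrow> nat \<Rightarrow> nat \<Rightarrow> nat \<Rightarrow> bool" where
  "candidate T z k v y \<longleftrightarrow> (z mod B = 0 \<longrightarrow> 1 \<le> v) \<and>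
     (\<forall>j<k. 0 < dig (Suc j) z \<longrightarrow> T (z - B ^ Suc j) \<le> v) \<and>
     (0 < v \<longrightarrow> z mod B = 0 \<and> v = 1 \<or>
        (\<exists>j<k. 0 < dig (Suc j) z \<and> y = z - B ^ Suc j \<and> v = T y))"

lemma prefix_matched_Suc:
  "prefix_matched z (Suc k) \<longleftrightarrow> prefix_matched z k \<and> 0 < dig (Suc k) z \<and>
     A (k * n + dig (Suc k) z - 1) = A (dig 1 z - 1)"
  by (auto simp: prefix_matched_def less_Suc_eq)

lemma candidate_Suc_0:
  assumes "candidate T z k v y" "dig (Suc k) z = 0"
  shows "candidate T z (Suc k) v y"
  using assms unfolding candidate_def by (metis less_Suc_eq less_irrefl)

lemma candidate_Suc_keep:
  assumes "candidate T z k v y" "T (z - B ^ Suc k) \<le> v"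
  shows "candidate T z (Suc k) v y"
  using assms unfolding candidate_def by (metis less_Suc_eq)

lemma candidate_Suc_update:
  assumes "candidate T z k v y" "0 < dig (Suc k) z" "v < T (z - B ^ Suc k)"
  shows "candidate T z (Suc k) (T (z - B ^ Suc k)) (z - B ^ Suc k)"
proof -
  have "T (z - B ^ Suc j) \<le> T (z - B ^ Suc k)" if "j < Suc k" "0 < dig (Suc j) z" for j
    using assms(1,3) that unfolding candidate_def
    by (metis less_Suc_eq less_imp_le order_refl order_trans)
  moreover have "1 \<le> T (z - B ^ Suc k)" using assms(3) by linarith
  ultimately show ?thesis using assms(2) unfolding candidate_def by blast
qed

definition skip_inv :: "(nat \<Rightarrow> nat) \<Rightarrow> (nat \<Rightarrow> nat) \<Rightarrow> nat \<Rightarrow> state \<Rightarrow> bool" where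
  "skip_inv T P z s \<longleftrightarrow> frame T P s \<and> vars s xZ = z \<and> vars s xK \<le> m \<and>
     vars s xY = z div B ^ Suc (vars s xK) \<and> vars s xPow = B ^ Suc (vars s xK) \<and>
     vars s xFirst = dig 1 z \<and> (0 < vars s xOk \<longleftrightarrow> prefix_matched z (vars s xK)) \<and>
     vars s xDiag \<le> z \<and> (0 < vars s xOk \<longrightarrow> vars s xDiag = z - (\<Sum>j<Suc (vars s xK). B ^ j)) \<and>
     candidate T z (vars s xK) (vars s xBest) (vars s xNext)"

lemma run_skip_body:
  assumes inv: "skip_inv T P z s" and z: "z < N" and k: "vars s xK < m"
  shows "run w skip_body s
    (\<lambda>t s'. t \<le> 60 \<and> skip_inv T P z s' \<and> m - vars s' xK < m - vars s xK)"
proof -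
  define k where "k = vars s xK"
  define e where "e = dig (Suc k) z"
  note inv' = inv[unfolded skip_inv_def frame_def, folded k_def]
  have km: "k < m" using k by (simp add: k_def)
  have zw: "z < 2 ^ w" using z N_less by linarith
  have y: "z div B ^ Suc k mod B = e" "z div B ^ Suc k div B = z div B ^ Suc (Suc k)"
    by (simp_all only: e_def digit_def power_Suc2 div_mult2_eq)
  have yw: "z div B ^ Suc (Suc k) < 2 ^ w" by (rule le_less_trans[OF div_le_dividend zw])
  have en: "e \<le> n" by (simp add: e_def digit_def B_def flip: less_Suc_eq_le)
  have "k * n + n \<le> m * n" using km by (metis Suc_leI add.commute mult_Suc mult_le_mono1)
  then have idx: "k * n + e < 2 ^ w" using en mn_less by linarith
  then have bnd: "e < 2 ^ w" "k * n < 2 ^ w" "k * n + e - Suc 0 < 2 ^ w" by linarith+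
  have "dig 1 z \<le> n" by (simp add: digit_def B_def flip: less_Suc_eq_le)
  then have f: "dig (Suc 0) z - Suc 0 < 2 ^ w" using mn_less by simp
  have "B ^ Suc (Suc k) \<le> N" using km by (intro power_le_N) simp
  then have pw: "B ^ Suc (Suc k) < 2 ^ w" using N_less by linarith
  have pB: "B ^ Suc k * B = B ^ Suc (Suc k)" by simp
  have kw: "Suc k < 2 ^ w" using km m_less by linarith
  have dw: "vars s xDiag - x < 2 ^ w" "z - x < 2 ^ w" for x
    using inv' zw by (meson diff_le_self le_less_trans)+
  have sum: "(\<Sum>j<Suc (Suc k). B ^ j) = (\<Sum>j<Suc k. B ^ j) + B ^ Suc k"
    by simp
  note pm = prefix_matched_Suc[of z k, folded e_def]
  have c0: "candidate T z (Suc k) (vars s xBest) (vars s xNext)" if "e = 0"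
    using candidate_Suc_0 inv' that unfolding e_def by blast
  have c1: "candidate T z (Suc k) (vars s xBest) (vars s xNext)"
    if "\<not> vars s xBest < T (z - B ^ Suc k)"
    using candidate_Suc_keep inv' that by (metis not_less)
  have c2: "candidate T z (Suc k) (T (z - B ^ Suc k)) (z - B ^ Suc k)"
    if "0 < e" "vars s xBest < T (z - B ^ Suc k)"
    using candidate_Suc_update inv' that unfolding e_def by blast
  have kk: "vars s xK = k" by (simp add: k_def)
  have dec: "vars s xDiag - x \<le> z" "m - Suc k < m - k" for x
    using inv' km by auto
  show ?thesis
    using inv' km
    apply (cases "e = 0"; cases "vars s xBest < T (z - B ^ Suc k)";
           cases "A (k * n + e - 1) = A (dig 1 z - 1)")
    by (simp_all add: skip_body_def skip_inv_def frame_def kk y yw bnd idx f pw pB kw dw sum pm c0 c1 c2 dec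
        del: power_Suc sum.lessThan_Suc)
qed

lemma run_cell_init:
  assumes "frame T P s" "vars s xZ = z" "z < N"
  shows "run w cell_init s (\<lambda>t s'. t \<le> 40 \<and> skip_inv T P z s' \<and> vars s' xK = 0)"
proof -
  have zw: "z < 2 ^ w" using assms(3) N_less by linarith
  have "z div B \<le> z" "z mod B \<le> z" "z div B mod B \<le> z div B" "z - Suc 0 \<le> z" by simp_all
  then have b: "z div B < 2 ^ w" "z mod B < 2 ^ w" "z div B mod B < 2 ^ w" "z - Suc 0 < 2 ^ w"
    using zw by linarith+
  then show ?thesis
    using assms
    by (simp add: cell_init_def skip_inv_def frame_def prefix_matched_def candidate_def digit_def)
qed

lemma run_match_store:
  assumes inv: "skip_inv T P z s" and z: "z < N" and k: "vars s xK = m"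
    and tab: "\<forall>y<z. good T P y"
  shows "run w (match_step ;; cell_store) s
    (\<lambda>t s'. t \<le> 40 \<and> (\<exists>T P. frame T P s' \<and> (\<forall>y<Suc z. good T P y)) \<and> vars s' xZ = Suc z)"
proof -
  note inv' = inv[unfolded skip_inv_def frame_def k]
  have zw: "Suc z < 2 ^ w" using z N_less by linarith
  have "dig 1 z \<le> n" by (simp add: digit_def B_def flip: less_Suc_eq_le)
  then have f: "dig 1 z - Suc 0 < 2 ^ w" using mn_less by linarith
  have mat: "prefix_matched z m = matched z" by (simp add: prefix_matched_def matched_def)
  have diag: "vars s xDiag = diag z" if "matched z"
    using inv' that by (simp add: mat diag_def del: sum.lessThan_Suc)
  have tb: "T (diag z) + of_bool b < 2 ^ w" if "matched z" for b
  proof -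
    have "T (diag z) \<le> 1 + diag z mod B"
      using tab diag_less[OF that] by (intro table_bound[where P = P]) auto
    moreover have "diag z mod B < B" by simp
    moreover have "(of_bool b :: nat) \<le> 1" by simp
    ultimately show ?thesis using B_le_N N_less B_pos by linarith
  qed
  have mk: "marked (dig 1 z - Suc 0) \<longleftrightarrow> Off (dig 1 z - Suc 0) < Off (dig 1 z)" if "matched z"
  proof -
    have "0 < dig 1 z" using that m_pos unfolding matched_def by (metis One_nat_def less_le_trans zero_less_one)
    then show ?thesis by (simp add: marked_def)
  qed
  have cand: "candidate T z m (vars s xBest) (vars s xNext)" using inv' by blast
  have fin: "\<forall>x<Suc z. good (T(z := v)) (P(z := y)) x"
    if "candidate T z m v0 y0" and
      "(if matched z \<and> 0 < T (diag z) \<and> v0 < T (diag z) + of_bool (marked (dig 1 z - Suc 0))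
        then v = T (diag z) + of_bool (marked (dig 1 z - Suc 0)) \<and> y = diag z
        else v = v0 \<and> y = y0)" for v y v0 y0
  proof (intro allI impI)
    fix x assume "x < Suc z"
    then consider "x < z" | "x = z" by linarith
    then show "good (T(z := v)) (P(z := y)) x"
    proof cases
      case 1
      then have "good T P x" using tab by blast
      then show ?thesis using 1 by (intro good_cong[of x "T(z := v)" T "P(z := y)" P]) simp_all
    next
      case 2
      have sk: "z - B ^ Suc j \<noteq> z" if "0 < dig (Suc j) z" for j
        using skip_less[OF that] by linarith
      have dg: "diag z \<noteq> z" if "matched z" using diag_less[OF that] by linarith
      show ?thesis
      proof (cases "matched z \<and> 0 < T (diag z) \<and> v0 < T (diag z) + of_bool (marked (dig 1 z - Suc 0))")
        case True
        then have v: "v = T (diag z) + of_bool (marked (dig 1 z - Suc 0))" "y = diag z" "v0 \<le> v"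
          using that(2)[unfolded if_P[OF True]] by simp_all
        have "T (z - B ^ Suc j) \<le> v" if "j < m" "0 < dig (Suc j) z" for j
          using \<open>candidate T z m v0 y0\<close> that v(3) unfolding candidate_def by (blast intro: order_trans)
        moreover have "0 < v" using True v by simp
        moreover have "(T(z := v)) (diag z) = T (diag z)" using dg True by simp
        moreover have "(T(z := v)) (z - B ^ Suc j) = T (z - B ^ Suc j)" if "0 < dig (Suc j) z" for j
          using sk[OF that] by (simp only: fun_upd_other not_False_eq_True)
        ultimately have "dominates (T(z := v)) z"
          using v(1) unfolding dominates_def fun_upd_same One_nat_def
          by (simp add: Suc_le_eq del: power_Suc fun_upd_apply)
        moreover have "justified (T(z := v)) z (diag z)"
          using True v(1) dg unfolding justified_def by simp
        ultimately have "dominates (T(z := v)) z \<and> justified (T(z := v)) z (diag z)" by blast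
        then show ?thesis using v(2) unfolding 2 good_def by simp
      next
        case False
        then have "v = v0" "y = y0" using that(2)[unfolded if_not_P[OF False]] by simp_all
        moreover have "justified (T(z := v0)) z y0" if "0 < v0"
        proof -
          consider "z mod B = 0" "v0 = 1"
            | j where "j < m" "0 < dig (Suc j) z" "y0 = z - B ^ Suc j" "v0 = T y0"
            using \<open>candidate T z m v0 y0\<close> \<open>0 < v0\<close> unfolding candidate_def by metis
          then show ?thesis
          proof cases
            case (2 j)
            then have "(T(z := v0)) z = (T(z := v0)) y0" using sk[OF 2(2)] by simp
            then show ?thesis using 2 unfolding justified_def by blast
          qed (simp add: justified_def)
        qed
        moreover have "dominates (T(z := v0)) z"
          unfolding dominates_def
        proof (intro conjI allI impI)
          show "1 \<le> (T(z := v0)) z" if "z mod B = 0"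
            using \<open>candidate T z m v0 y0\<close> that unfolding candidate_def by simp
          show "(T(z := v0)) (z - B ^ Suc j) \<le> (T(z := v0)) z"
            if "j < m" "0 < dig (Suc j) z" for j
            using \<open>candidate T z m v0 y0\<close> that sk[OF that(2)] unfolding candidate_def
            by (simp only: fun_upd_same fun_upd_other not_False_eq_True)
          show "(T(z := v0)) (diag z) + of_bool (marked (dig 1 z - 1)) \<le> (T(z := v0)) z"
            if "matched z" "0 < (T(z := v0)) (diag z)"
            using False that dg[OF that(1)] by (simp add: not_less)
        qed
        ultimately show ?thesis unfolding 2 good_def by simp
      qed
    qed
  qed
  have run: "run w (match_step ;; cell_store) s
    (\<lambda>t s'. t \<le> 40 \<and> frame (T(z := v)) (P(z := y)) s' \<and> vars s' xZ = Suc z)"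
    if "(if matched z \<and> 0 < T (diag z) \<and>
          vars s xBest < T (diag z) + of_bool (marked (dig 1 z - Suc 0))
        then v = T (diag z) + of_bool (marked (dig 1 z - Suc 0)) \<and> y = diag z
        else v = vars s xBest \<and> y = vars s xNext)" for v y
  proof (cases "matched z")
    case True
    then have ok: "0 < vars s xOk" using inv' by (simp add: mat)
    have f: "dig (Suc 0) z - Suc 0 < 2 ^ w" using f by simp
    define g :: nat where "g = of_bool (marked (dig (Suc 0) z - Suc 0))"
    have g: "of_bool (Off (dig (Suc 0) z - Suc 0) < Off (dig (Suc 0) z)) = g"
      using mk[OF True] by (simp add: g_def)
    have gw: "T (diag z) + g < 2 ^ w" unfolding g_def by (rule tb[OF True])
    then have gw': "g < 2 ^ w" by linarith
    have vals: "frame T P s" "vars s xZ = z" "vars s xFirst = dig 1 z" "vars s xDiag = diag z"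
      using inv diag[OF True] unfolding skip_inv_def by blast+
    have vy: "if matched z \<and> 0 < T (diag z) \<and> vars s xBest < T (diag z) + g
      then v = T (diag z) + g \<and> y = diag z else v = vars s xBest \<and> y = vars s xNext"
      using that by (simp add: g_def)
    show ?thesis
      using vy vals[unfolded frame_def]
      by (cases "T (diag z) = 0"; cases "vars s xBest < T (diag z) + g")
         (simp_all add: match_step_def cell_store_def frame_def ok f g gw gw' True zw)
  next
    case False
    then have "vars s xOk = 0" using inv' by (simp add: mat)
    then show ?thesis using inv' that False
      by (simp add: match_step_def cell_store_def frame_def zw del: power_Suc sum.lessThan_Suc)
  qed
  define v where "v = (if matched z \<and> 0 < T (diag z) \<and>
    vars s xBest < T (diag z) + of_bool (marked (dig 1 z - Suc 0))
    then T (diag z) + of_bool (marked (dig 1 z - Suc 0)) else vars s xBest)"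
  define y where "y = (if matched z \<and> 0 < T (diag z) \<and>
    vars s xBest < T (diag z) + of_bool (marked (dig 1 z - Suc 0))
    then diag z else vars s xNext)"
  have vy: "(if matched z \<and> 0 < T (diag z) \<and>
          vars s xBest < T (diag z) + of_bool (marked (dig 1 z - Suc 0))
        then v = T (diag z) + of_bool (marked (dig 1 z - Suc 0)) \<and> y = diag z
        else v = vars s xBest \<and> y = vars s xNext)"
    by (simp add: v_def y_def)
  show ?thesis
    by (rule run_mono[OF run[OF vy]]) (use fin[OF cand vy] in blast)
qed

lemma run_cell_body:
  assumes fr: "frame T P s" and z: "vars s xZ = z" "z < N" and tab: "\<forall>y<z. good T P y"
  shows "run w cell_body s (\<lambda>t s'. t \<le> 64 * m + 84 \<and>
    (\<exists>T P. frame T P s' \<and> (\<forall>y<Suc z. good T P y)) \<and> vars s' xZ = Suc z)"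
proof -
  have loop: "run w (While (Bin Less (Var xK) (Var xM)) skip_body) s0
    (\<lambda>t s'. t \<le> (m - vars s0 xK) * (1 + exp_cost (Bin Less (Var xK) (Var xM)) + 60)
       + (1 + exp_cost (Bin Less (Var xK) (Var xM))) \<and>
       skip_inv T P z s' \<and> eval w s' (Bin Less (Var xK) (Var xM)) = 0)"
    if "skip_inv T P z s0" for s0
  proof (rule run_While[where I = "skip_inv T P z", OF that])
    fix s1 assume I: "skip_inv T P z s1" and "eval w s1 (Bin Less (Var xK) (Var xM)) \<noteq> 0"
    then have "vars s1 xK < m" by (simp add: skip_inv_def frame_def)
    then show "run w skip_body s1
      (\<lambda>t s'. t \<le> 60 \<and> skip_inv T P z s' \<and> m - vars s' xK < m - vars s1 xK)"
      by (rule run_skip_body[OF I z(2)])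
  qed
  show ?thesis
    unfolding cell_body_def
  proof (rule run_SeqI[OF run_cell_init[OF fr z]], rule run_SeqI[OF loop])
    fix t1 t2 :: nat and s1 s2 :: state
    assume 1: "t1 \<le> 40 \<and> skip_inv T P z s1 \<and> vars s1 xK = 0"
    then show "skip_inv T P z s1" by simp
    assume 2: "t2 \<le> (m - vars s1 xK) * (1 + exp_cost (Bin Less (Var xK) (Var xM)) + 60)
       + (1 + exp_cost (Bin Less (Var xK) (Var xM))) \<and>
       skip_inv T P z s2 \<and> eval w s2 (Bin Less (Var xK) (Var xM)) = 0"
    then have inv: "skip_inv T P z s2" and "vars s2 xK = m"
      by (auto simp: skip_inv_def frame_def)
    then show "run w (match_step ;; cell_store) s2 (\<lambda>t3 s'. t1 + (t2 + t3) \<le> 64 * m + 84 \<and>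
      (\<exists>T P. frame T P s' \<and> (\<forall>y<Suc z. good T P y)) \<and> vars s' xZ = Suc z)"
      using 1 2 by (intro run_mono[OF run_match_store[OF inv z(2) _ tab]]) auto
  qed
qed

lemma run_fill_table:
  assumes "frame T P s"
  shows "run w fill_table s (\<lambda>t s'. t \<le> N * (88 + 64 * m) + 6 \<and>
    (\<exists>T P. frame T P s' \<and> (\<forall>z<N. good T P z)))"
proof -
  define I where "I s' \<longleftrightarrow> vars s' xZ \<le> N \<and>
    (\<exists>T P. frame T P s' \<and> (\<forall>y<vars s' xZ. good T P y))" for s' :: state
  have loop: "run w (While (Bin Less (Var xZ) (Var xSize)) cell_body) s0
    (\<lambda>t s'. t \<le> (N - vars s0 xZ) * (1 + exp_cost (Bin Less (Var xZ) (Var xSize)) + (64 * m + 84))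
       + (1 + exp_cost (Bin Less (Var xZ) (Var xSize))) \<and>
       I s' \<and> eval w s' (Bin Less (Var xZ) (Var xSize)) = 0)" if "I s0" for s0
  proof (rule run_While[where I = I, OF that])
    fix s1 assume I: "I s1" and ev: "eval w s1 (Bin Less (Var xZ) (Var xSize)) \<noteq> 0"
    from I obtain T P where fr: "frame T P s1" and tab: "\<forall>y<vars s1 xZ. good T P y"
      unfolding I_def by blast
    then have less: "vars s1 xZ < N" using ev by (simp add: frame_def)
    show "run w cell_body s1 (\<lambda>t s'. t \<le> 64 * m + 84 \<and> I s' \<and> N - vars s' xZ < N - vars s1 xZ)"
      by (rule run_mono[OF run_cell_body[OF fr refl less tab]]) (use less in \<open>auto simp: I_def\<close>)
  qed
  show ?thesis
    unfolding fill_table_def run_Seq run_Assign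
  proof (rule run_mono[OF loop])
    show "I (s\<lparr>vars := (vars s)(xZ := eval w s (Lit 0))\<rparr>)"
      using assms by (auto simp: I_def frame_def)
  next
    fix t s'
    assume *: "t \<le> (N - vars (s\<lparr>vars := (vars s)(xZ := eval w s (Lit 0))\<rparr>) xZ) *
        (1 + exp_cost (Bin Less (Var xZ) (Var xSize)) + (64 * m + 84)) +
        (1 + exp_cost (Bin Less (Var xZ) (Var xSize))) \<and>
        I s' \<and> eval w s' (Bin Less (Var xZ) (Var xSize)) = 0"
    then obtain T P where fr: "frame T P s'" and tab: "\<forall>y<vars s' xZ. good T P y"
      and "vars s' xZ \<le> N" unfolding I_def by blast
    then have "vars s' xZ = N" using * by (simp add: frame_def)
    then show "1 + exp_cost (Lit 0) + t \<le> N * (88 + 64 * m) + 6 \<and>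
      (\<exists>T P. frame T P s' \<and> (\<forall>z<N. good T P z))"
      using * fr tab by auto
  qed
qed

definition scanned :: "(nat \<Rightarrow> nat) \<Rightarrow> nat \<Rightarrow> nat \<Rightarrow> nat \<Rightarrow> bool" where
  "scanned T e v y \<longleftrightarrow> (\<forall>z. N - 1 - d \<le> z \<longrightarrow> z < e \<longrightarrow> T z \<le> v) \<and>
     (0 < v \<longrightarrow> N - 1 - d \<le> y \<and> y < N \<and> T y = v)"

lemma run_scan:
  assumes "frame T P s"
  shows "run w scan s (\<lambda>t s'. t \<le> 20 * N + 20 \<and> frame T P s' \<and>
    scanned T N (vars s' xBest) (vars s' xNext))"
proof -
  define I where "I s' \<longleftrightarrow> frame T P s' \<and> N - 1 - d \<le> vars s' xZ \<and> vars s' xZ \<le> N \<and>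
    scanned T (vars s' xZ) (vars s' xBest) (vars s' xNext)" for s' :: state
  have loop: "run w (While (Bin Less (Var xZ) (Var xSize)) scan_body) s0
    (\<lambda>t s'. t \<le> (N - vars s0 xZ) * (1 + exp_cost (Bin Less (Var xZ) (Var xSize)) + 16)
       + (1 + exp_cost (Bin Less (Var xZ) (Var xSize))) \<and>
       I s' \<and> eval w s' (Bin Less (Var xZ) (Var xSize)) = 0)" if "I s0" for s0
  proof (rule run_While[where I = I, OF that])
    fix s1 assume I: "I s1" and ev: "eval w s1 (Bin Less (Var xZ) (Var xSize)) \<noteq> 0"
    define z where "z = vars s1 xZ"
    have less: "z < N" using ev I by (simp add: I_def frame_def z_def)
    then have zw: "Suc z < 2 ^ w" using N_less by linarith
    have sc: "scanned T z (vars s1 xBest) (vars s1 xNext)" "N - 1 - d \<le> z"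
      using I by (simp_all add: I_def z_def)
    have keep: "scanned T (Suc z) (vars s1 xBest) (vars s1 xNext)" if "\<not> vars s1 xBest < T z"
      using sc(1) that unfolding scanned_def by (metis less_Suc_eq not_less)
    have upd: "scanned T (Suc z) (T z) z" if "vars s1 xBest < T z"
      unfolding scanned_def using sc that less unfolding scanned_def
      by (metis less_Suc_eq less_imp_le order_refl order_trans)
    show "run w scan_body s1 (\<lambda>t s'. t \<le> 16 \<and> I s' \<and> N - vars s' xZ < N - vars s1 xZ)"
      using I less zw keep upd sc(2) unfolding I_def frame_def
      by (cases "vars s1 xBest < T z") (simp_all add: scan_body_def z_def[symmetric] diff_less_mono2)
  qed
  have start: "eval w s (Bin Sub (Bin Sub (Var xSize) (Lit 1)) (Var xD)) = N - 1 - d"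
  proof -
    have "N - Suc 0 < 2 ^ w" "N - Suc 0 - d < 2 ^ w" using N_less by linarith+
    then show ?thesis using assms by (simp add: frame_def)
  qed
  show ?thesis
    unfolding scan_def run_Seq run_Assign start
  proof (rule run_mono[OF loop], goal_cases)
    case 1
    show ?case using assms by (simp add: I_def frame_def scanned_def)
  next
    case (2 t s')
    then have "vars s' xZ = N" by (auto simp: I_def frame_def)
    moreover have "(N - (N - 1 - d)) * 20 \<le> N * 20" by (intro mult_right_mono) auto
    ultimately show ?case using 2 by (auto simp: I_def)
  qed
qed

definition traced :: "(nat \<Rightarrow> nat) \<Rightarrow> nat \<Rightarrow> nat \<Rightarrow> (nat \<Rightarrow> nat) \<Rightarrow> (nat \<Rightarrow> nat) \<Rightarrow> bool" where
  "traced T z0 z X E \<longleftrightarrow>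
     (\<forall>k<m. \<forall>t. z mod B \<le> t \<longrightarrow> t < z0 mod B \<longrightarrow>
        dig (Suc k) z \<le> E (k * n + t) \<and> E (k * n + t) < n \<and> A (k * n + E (k * n + t)) = X t) \<and>
     (\<forall>k<m. \<forall>t u. z mod B \<le> t \<longrightarrow> t < u \<longrightarrow> u < z0 mod B \<longrightarrow> E (k * n + t) < E (k * n + u)) \<and>
     T z + (\<Sum>t = z mod B..<z0 mod B. of_bool (marked (E t))) = T z0"

lemma traced_step:
  assumes good: "good T P z" and pos: "0 < T z" "0 < z mod B" and le: "z mod B \<le> z0 mod B"
    and tr: "traced T z0 z X E"
    and X: "X' = X(z mod B - 1 := A (dig 1 z - 1))"
    and E: "\<And>k. k < m \<Longrightarrow> E' (k * n + (z mod B - 1)) = dig (Suc k) z - 1"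
      "\<And>k t. k < m \<Longrightarrow> t < n \<Longrightarrow> t \<noteq> z mod B - 1 \<Longrightarrow> E' (k * n + t) = E (k * n + t)"
  shows "P z < z \<and> 0 < T (P z) \<and> P z mod B \<le> z0 mod B \<and> traced T z0 (P z) X' E'"
proof -
  define l where "l = z mod B - 1"
  have l: "z mod B = Suc l" using pos by (simp add: l_def)
  have Ln: "z0 mod B \<le> n" by (simp add: B_def flip: less_Suc_eq_le)
  have E0: "E' t = E t" if "t < n" "t \<noteq> l" for t
    using E(2)[of 0 t] that m_pos by (simp add: l_def)
  have E1: "E' (k * n + l) = dig (Suc k) z - 1" if "k < m" for k using E(1)[OF that] by (simp add: l_def)
  have E2: "E' (k * n + t) = E (k * n + t)" if "k < m" "Suc l \<le> t" "t < z0 mod B" for k t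
    using E(2)[OF that(1), of t] that Ln by (simp add: l_def)
  have X1: "X' l = A (dig 1 z - 1)" "\<And>t. Suc l \<le> t \<Longrightarrow> X' t = X t" by (simp_all add: X l_def)
  have tr1: "dig (Suc k) z \<le> E (k * n + t)" "E (k * n + t) < n" "A (k * n + E (k * n + t)) = X t"
    if "k < m" "Suc l \<le> t" "t < z0 mod B" for k t
    using tr that unfolding traced_def l by blast+
  have tr2: "E (k * n + t) < E (k * n + u)" if "k < m" "Suc l \<le> t" "t < u" "u < z0 mod B" for k t u
    using tr that unfolding traced_def l by blast
  have tr3: "T z + (\<Sum>t = Suc l..<z0 mod B. of_bool (marked (E t))) = T z0"
    using tr unfolding traced_def l by blast
  have sum: "(\<Sum>t = Suc l..<z0 mod B. of_bool (marked (E' t))) =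
      (\<Sum>t = Suc l..<z0 mod B. of_bool (marked (E t)) :: nat)"
    using E0 Ln by (intro sum.cong) auto
  have "justified T z (P z)" using good pos by (simp add: good_def)
  then consider k where "k < m" "0 < dig (Suc k) z" "P z = z - B ^ Suc k" "T z = T (P z)"
    | "matched z" "P z = diag z" "0 < T (P z)" "T z = T (P z) + of_bool (marked (dig 1 z - 1))"
    using pos(2) unfolding justified_def by (metis less_irrefl)
  then show ?thesis
  proof cases
    case (1 k)
    have md: "P z mod B = Suc l" using skip_mod[OF 1(2)] 1(3) l by simp
    have dg: "dig (Suc j) (P z) \<le> dig (Suc j) z" for j using dig_skip[OF 1(2)] 1(3) by simp
    have "traced T z0 (P z) X' E'"
      unfolding traced_def md
    proof (intro conjI allI impI)
      fix j t assume t: "j < m" "Suc l \<le> t" "t < z0 mod B"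
      show "dig (Suc j) (P z) \<le> E' (j * n + t)" using tr1(1)[OF t] dg[of j] E2[OF t] by simp
      show "E' (j * n + t) < n" using tr1(2)[OF t] E2[OF t] by simp
      show "A (j * n + E' (j * n + t)) = X' t" using tr1(3)[OF t] E2[OF t] X1(2)[OF t(2)] by simp
    next
      fix j t u assume "j < m" "Suc l \<le> t" "t < u" "u < z0 mod B"
      then show "E' (j * n + t) < E' (j * n + u)" using tr2 E2 by simp
    next
      show "T (P z) + (\<Sum>t = Suc l..<z0 mod B. of_bool (marked (E' t))) = T z0"
        using tr3 sum 1(4) by simp
    qed
    then show ?thesis using 1 pos le skip_less[OF 1(2)] md l by simp
  next
    case 2
    have md: "P z mod B = l" using diag_mod[OF 2(1)] 2(2) l by simp
    have dg: "dig (Suc j) (P z) = dig (Suc j) z - 1" "0 < dig (Suc j) z" "dig (Suc j) z \<le> n"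
      "A (j * n + (dig (Suc j) z - 1)) = A (dig 1 z - 1)" if "j < m" for j
    proof -
      show "dig (Suc j) (P z) = dig (Suc j) z - 1" using dig_diag[OF 2(1)] 2(2) that by simp
      show *: "0 < dig (Suc j) z" using 2(1) that by (simp add: matched_def)
      show "dig (Suc j) z \<le> n" by (simp add: digit_def B_def flip: less_Suc_eq_le)
      show "A (j * n + (dig (Suc j) z - 1)) = A (dig 1 z - 1)"
        using 2(1) that * unfolding matched_def by (metis Nat.add_diff_assoc Suc_leI One_nat_def)
    qed
    have "traced T z0 (P z) X' E'"
      unfolding traced_def md
    proof (intro conjI allI impI)
      fix j t assume t: "j < m" "l \<le> t" "t < z0 mod B"
      have "dig (Suc j) (P z) \<le> E' (j * n + t) \<and> E' (j * n + t) < n \<and>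
        A (j * n + E' (j * n + t)) = X' t"
      proof (cases "t = l")
        case True
        then show ?thesis using dg[OF t(1)] E1[OF t(1)] X1(1) by simp
      next
        case False
        then have t': "Suc l \<le> t" using t(2) by simp
        show ?thesis
          using tr1[OF t(1) t' t(3)] dg(1)[OF t(1)] E2[OF t(1) t' t(3)] X1(2)[OF t'] by simp
      qed
      then show "dig (Suc j) (P z) \<le> E' (j * n + t)" "E' (j * n + t) < n"
        "A (j * n + E' (j * n + t)) = X' t" by blast+
    next
      fix j t u assume t: "j < m" "l \<le> t" "t < u" "u < z0 mod B"
      then have u: "Suc l \<le> u" by simp
      show "E' (j * n + t) < E' (j * n + u)"
      proof (cases "t = l")
        case True
        then show ?thesis
          using E1[OF t(1)] E2[OF t(1) u t(4)] tr1(1)[OF t(1) u t(4)] dg(2)[OF t(1)] by simp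
      next
        case False
        then show ?thesis using t tr2 E2 by simp
      qed
    next
      have El: "E' l = dig 1 z - 1" using E1[of 0] m_pos by simp
      have "(\<Sum>t = l..<z0 mod B. of_bool (marked (E' t)) :: nat) =
          of_bool (marked (E' l)) + (\<Sum>t = Suc l..<z0 mod B. of_bool (marked (E' t)))"
        using le l by (intro sum.atLeast_Suc_lessThan) linarith
      then show "T (P z) + (\<Sum>t = l..<z0 mod B. of_bool (marked (E' t))) = T z0"
        using tr3 2(4) unfolding sum El by linarith
    qed
    then show ?thesis using 2 le diag_less[OF 2(1)] md l by simp
  qed
qed

definition write_inv :: "(nat \<Rightarrow> nat) \<Rightarrow> (nat \<Rightarrow> nat) \<Rightarrow> nat \<Rightarrow> nat \<Rightarrow> (nat \<Rightarrow> nat) \<Rightarrow> (nat \<Rightarrow> nat) \<Rightarrow> state \<Rightarrow> bool" where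
  "write_inv T P z L X E s \<longleftrightarrow> frame T P s \<and> vars s xZ = z \<and> vars s xLen = L \<and>
     vars s xTmp = z mod B - 1 \<and> vars s xK \<le> m \<and> vars s xY = z div B ^ Suc (vars s xK) \<and>
     arrs s aChars = X \<and>
     (\<forall>k<vars s xK. arrs s aEmb (k * n + (z mod B - 1)) = dig (Suc k) z - 1) \<and>
     (\<forall>k<m. \<forall>t<n. t \<noteq> z mod B - 1 \<longrightarrow> arrs s aEmb (k * n + t) = E (k * n + t))"

lemma run_write_body:
  assumes inv: "write_inv T P z L X E s" and z: "z < N" "0 < z mod B" and k: "vars s xK < m"
  shows "run w write_body s
    (\<lambda>t s'. t \<le> 20 \<and> write_inv T P z L X E s' \<and> m - vars s' xK < m - vars s xK)"
proof -
  define k where "k = vars s xK"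
  define l where "l = z mod B - 1"
  define e where "e = dig (Suc k) z"
  define E0 where "E0 = arrs s aEmb"
  note inv' = inv[unfolded write_inv_def frame_def, folded k_def l_def E0_def]
  have km: "k < m" using k by (simp add: k_def)
  have zw: "z < 2 ^ w" using z N_less by linarith
  have y: "z div B ^ Suc k mod B = e" "z div B ^ Suc k div B = z div B ^ Suc (Suc k)"
    by (simp_all only: e_def digit_def power_Suc2 div_mult2_eq)
  have yw: "z div B ^ Suc (Suc k) < 2 ^ w" by (rule le_less_trans[OF div_le_dividend zw])
  have en: "e \<le> n" by (simp add: e_def digit_def B_def flip: less_Suc_eq_le)
  have "z mod B \<le> n" by (simp add: B_def flip: less_Suc_eq_le)
  then have ln: "l < n" using z(2) by (simp add: l_def)
  have "k * n + n \<le> m * n" using km by (metis Suc_leI add.commute mult_Suc mult_le_mono1)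
  then have idx: "k * n < 2 ^ w" "k * n + l < 2 ^ w" using ln mn_less by linarith+
  have ew: "e < 2 ^ w" "e - Suc 0 < 2 ^ w" using en mn_less by linarith+
  have kw: "Suc k < 2 ^ w" using km m_less by linarith
  have kk: "vars s xK = k" by (simp add: k_def)
  have dec: "m - Suc k < m - k" using km by linarith
  have lS: "z mod B - Suc 0 = l" by (simp add: l_def)
  have e1: "(E0(k * n + l := e - Suc 0)) (j * n + l) = dig (Suc j) z - Suc 0" if "j < Suc k" for j
    using inv' that mult_add_eq_iff[OF ln ln, of j k] by (auto simp: less_Suc_eq e_def)
  have e2: "(E0(k * n + l := e - Suc 0)) (j * n + t) = E (j * n + t)" if "j < m" "t < n" "t \<noteq> l" for j t
    using inv' that mult_add_eq_iff[OF that(2) ln, of j k] by simp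
  show ?thesis
    using inv' km e1 e2
    by (simp add: write_body_def write_inv_def frame_def kk y yw idx ew kw dec lS
        flip: E0_def del: power_Suc fun_upd_apply add: fun_upd_same fun_upd_other)
qed

lemma run_trace_body:
  assumes fr: "frame T P s" and z: "vars s xZ = z" "z < N" "0 < z mod B" and L: "vars s xLen = z0 mod B"
    and tab: "good T P z" "0 < T z" "z mod B \<le> z0 mod B"
    and tr: "traced T z0 z (arrs s aChars) (arrs s aEmb)"
  shows "run w trace_body s (\<lambda>t s'. t \<le> 24 * m + 40 \<and> frame T P s' \<and> vars s' xLen = z0 mod B \<and>
    vars s' xZ < z \<and> 0 < T (vars s' xZ) \<and> vars s' xZ mod B \<le> z0 mod B \<and>
    traced T z0 (vars s' xZ) (arrs s' aChars) (arrs s' aEmb))"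
proof -
  define X where "X = (arrs s aChars)(z mod B - 1 := A (dig 1 z - 1))"
  define E where "E = arrs s aEmb"
  have loop: "run w (While (Bin Less (Var xK) (Var xM)) write_body) s0
    (\<lambda>t s'. t \<le> (m - vars s0 xK) * (1 + exp_cost (Bin Less (Var xK) (Var xM)) + 20)
       + (1 + exp_cost (Bin Less (Var xK) (Var xM))) \<and>
       write_inv T P z (z0 mod B) X E s' \<and> eval w s' (Bin Less (Var xK) (Var xM)) = 0)"
    if "write_inv T P z (z0 mod B) X E s0" for s0
  proof (rule run_While[where I = "write_inv T P z (z0 mod B) X E", OF that])
    fix s1 assume I: "write_inv T P z (z0 mod B) X E s1"
      and "eval w s1 (Bin Less (Var xK) (Var xM)) \<noteq> 0"
    then have "vars s1 xK < m" by (simp add: write_inv_def frame_def)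
    then show "run w write_body s1 (\<lambda>t s'. t \<le> 20 \<and> write_inv T P z (z0 mod B) X E s' \<and>
      m - vars s' xK < m - vars s1 xK)"
      by (rule run_write_body[OF I z(2,3)])
  qed
  define init where "init = (xTmp ::= Bin Sub (Bin Mod (Var xZ) (Var xBase)) (Lit 1) ;;
      xY ::= Bin Div (Var xZ) (Var xBase) ;;
      Store aChars (Var xTmp)
        (Load aStrings (Bin Sub (Bin Mod (Var xY) (Var xBase)) (Lit 1))) ;;
      xK ::= Lit 0)"
  have zw: "z < 2 ^ w" using z N_less by linarith
  have "z div B \<le> z" "z mod B \<le> z" "z div B mod B \<le> z div B" by simp_all
  then have b: "z div B < 2 ^ w" "z mod B < 2 ^ w" "z div B mod B < 2 ^ w"
    "z mod B - Suc 0 < 2 ^ w" "z div B mod B - Suc 0 < 2 ^ w"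
    using zw by linarith+
  have init: "run w init s (\<lambda>t s'. t \<le> 25 \<and> write_inv T P z (z0 mod B) X E s' \<and> vars s' xK = 0)"
    using fr z L b by (simp add: init_def write_inv_def frame_def X_def E_def digit_def)
  have body: "run w trace_body s Q =
    run w (init ;; While (Bin Less (Var xK) (Var xM)) write_body ;; xZ ::= Load aNext (Var xZ)) s Q" for Q
    unfolding trace_body_def init_def run_Seq by (simp add: add.assoc)
  show ?thesis
    unfolding body
  proof (rule run_SeqI[OF init], rule run_SeqI[OF loop])
    fix t1 t2 :: nat and s1 s2 :: state
    assume 1: "t1 \<le> 25 \<and> write_inv T P z (z0 mod B) X E s1 \<and> vars s1 xK = 0"
    then show "write_inv T P z (z0 mod B) X E s1" by simp
    assume 2: "t2 \<le> (m - vars s1 xK) * (1 + exp_cost (Bin Less (Var xK) (Var xM)) + 20)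
       + (1 + exp_cost (Bin Less (Var xK) (Var xM))) \<and>
       write_inv T P z (z0 mod B) X E s2 \<and> eval w s2 (Bin Less (Var xK) (Var xM)) = 0"
    then have inv: "write_inv T P z (z0 mod B) X E s2" and k: "vars s2 xK = m"
      by (auto simp: write_inv_def frame_def)
    have "P z < z \<and> 0 < T (P z) \<and> P z mod B \<le> z0 mod B \<and>
        traced T z0 (P z) (arrs s2 aChars) (arrs s2 aEmb)"
    proof (rule traced_step[OF tab(1,2) z(3) tab(3) tr])
      show "arrs s2 aChars = (arrs s aChars)(z mod B - 1 := A (dig 1 z - 1))"
        using inv by (simp add: write_inv_def X_def)
      show "arrs s2 aEmb (k * n + (z mod B - 1)) = dig (Suc k) z - 1" if "k < m" for k
        using inv that k by (simp add: write_inv_def)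
      show "arrs s2 aEmb (k * n + t) = arrs s aEmb (k * n + t)"
        if "k < m" "t < n" "t \<noteq> z mod B - 1" for k t
        using inv that k by (simp add: write_inv_def E_def)
    qed
    then show "run w (xZ ::= Load aNext (Var xZ)) s2 (\<lambda>t3 s'. t1 + (t2 + t3) \<le> 24 * m + 40 \<and>
      frame T P s' \<and> vars s' xLen = z0 mod B \<and>
      vars s' xZ < z \<and> 0 < T (vars s' xZ) \<and> vars s' xZ mod B \<le> z0 mod B \<and>
      traced T z0 (vars s' xZ) (arrs s' aChars) (arrs s' aEmb))"
      using inv 1 2 by (simp add: write_inv_def frame_def)
  qed
qed

lemma run_trace:
  assumes fr: "frame T P s" and tab: "\<forall>z<N. good T P z"
    and sc: "scanned T N (vars s xBest) (vars s xNext)"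
  shows "run w trace s (\<lambda>t s'. t \<le> N * (24 * m + 44) + 20 \<and>
    (if vars s xBest = 0 then vars s' xFound = 0
     else vars s' xFound \<noteq> 0 \<and> vars s' xLen = vars s xNext mod B \<and>
       (\<exists>z. z mod B = 0 \<and> T z = 1 \<and> traced T (vars s xNext) z (arrs s' aChars) (arrs s' aEmb))))"
proof (cases "vars s xBest = 0")
  case True
  then show ?thesis using fr by (simp add: trace_def frame_def)
next
  case False
  define z0 where "z0 = vars s xNext"
  have z0: "z0 < N" "0 < T z0" using sc False by (auto simp: scanned_def z0_def)
  define I where "I s' \<longleftrightarrow> frame T P s' \<and> vars s' xLen = z0 mod B \<and>
    vars s' xZ < N \<and> 0 < T (vars s' xZ) \<and> vars s' xZ mod B \<le> z0 mod B \<and>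
    traced T z0 (vars s' xZ) (arrs s' aChars) (arrs s' aEmb)" for s' :: state
  have ev: "eval w s' (Bin Mod (Var xZ) (Var xBase)) = vars s' xZ mod B" if "I s'" for s'
  proof -
    have "vars s' xZ mod B \<le> vars s' xZ" by simp
    then have "vars s' xZ mod B < 2 ^ w" using that N_less unfolding I_def by linarith
    then show ?thesis using that by (simp add: I_def frame_def)
  qed
  have loop: "run w (While (Bin Mod (Var xZ) (Var xBase)) trace_body) s0
    (\<lambda>t s'. t \<le> vars s0 xZ * (1 + exp_cost (Bin Mod (Var xZ) (Var xBase)) + (24 * m + 40))
       + (1 + exp_cost (Bin Mod (Var xZ) (Var xBase))) \<and>
       I s' \<and> eval w s' (Bin Mod (Var xZ) (Var xBase)) = 0)" if "I s0" for s0
  proof (rule run_While[where I = I and \<mu> = "\<lambda>s. vars s xZ", OF that])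
    fix s1 assume I: "I s1" and "eval w s1 (Bin Mod (Var xZ) (Var xBase)) \<noteq> 0"
    then have pos: "0 < vars s1 xZ mod B" using ev by simp
    show "run w trace_body s1 (\<lambda>t s'. t \<le> 24 * m + 40 \<and> I s' \<and> vars s' xZ < vars s1 xZ)"
      by (rule run_mono[OF run_trace_body[of T P s1 "vars s1 xZ" z0]])
         (use I pos tab in \<open>auto simp: I_def\<close>)
  qed
  have mod: "z0 mod B < 2 ^ w" 
    using z0 N_less mod_less_eq_dividend[of z0 B] by linarith
  define s0 where "s0 = s\<lparr>vars := (vars s)(xZ := z0, xLen := z0 mod B)\<rparr>"
  have I0: "I s0" using fr z0 by (simp add: I_def s0_def frame_def traced_def)
  have bound: "vars s0 xZ * (44 + 24 * m) \<le> N * (44 + 24 * m)"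
    using z0 by (intro mult_right_mono) (auto simp: s0_def)
  have "run w (While (Bin Mod (Var xZ) (Var xBase)) trace_body ;; xFound ::= Lit 1) s0
    (\<lambda>t s'. t \<le> N * (24 * m + 44) + 8 \<and> vars s' xFound \<noteq> 0 \<and> vars s' xLen = z0 mod B \<and>
       (\<exists>z. z mod B = 0 \<and> T z = 1 \<and> traced T z0 z (arrs s' aChars) (arrs s' aEmb)))"
  proof (rule run_SeqI[OF loop[OF I0]], goal_cases)
    case (1 t s')
    then have I: "I s'" and "eval w s' (Bin Mod (Var xZ) (Var xBase)) = 0" by blast+
    then have 0: "vars s' xZ mod B = 0" unfolding ev[OF I] by blast
    have "T (vars s' xZ) \<le> 1 + vars s' xZ mod B"
      using tab I by (intro table_bound[where P = P]) (auto simp: I_def)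
    then have "T (vars s' xZ) = 1" using 0 I by (simp add: I_def)
    then have "\<exists>z. z mod B = 0 \<and> T z = 1 \<and> traced T z0 z (arrs s' aChars) (arrs s' aEmb)"
      using I 0 unfolding I_def by metis
    moreover have "t \<le> N * (24 * m + 44) + 4" 
    proof -
      have "t \<le> vars s0 xZ * (44 + 24 * m) + 4" using 1 by (simp add: add.commute)
      then show ?thesis using bound unfolding add.commute[of "24 * m"] by linarith
    qed
    ultimately show ?case using I by (simp add: I_def)
  qed
  then show ?thesis
    using False fr mod unfolding s0_def z0_def
    by (simp add: trace_def frame_def) (erule run_mono, simp)
qed

lemma feasible_iff:
  assumes "length ss = m" "\<forall>s\<in>set ss. length s = n"
  shows "feasible ss n d \<sigma> \<longleftrightarrow> common_alignment ss \<sigma> \<and> n \<le> d + length (fst \<sigma>)"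
proof (cases "common_alignment ss \<sigma>")
  case True
  have "card (unaligned n \<sigma> k) = n - length (fst \<sigma>)" if "k < m" for k
  proof -
    have "length (ss ! k) = n" using assms that by simp
    then show ?thesis
      using common_alignment_length[OF True, of k] that assms(1)
      by (simp add: unaligned_def aligned_def card_Diff_subset distinct_card)
  qed
  then have "(\<Sum>k<length ss. card (unaligned n \<sigma> k)) = (n - length (fst \<sigma>)) * m"
    using assms(1) by (simp add: mult.commute)
  then show ?thesis using True m_pos assms(1) by (auto simp: feasible_def)
qed (simp add: feasible_def)

lemma objective_eq:
  assumes "length ss = m" "\<forall>s\<in>set ss. length s = n"
    and marked: "\<And>i. i < n \<Longrightarrow> marked i \<longleftrightarrow> (\<exists>j<length Ss. i \<in> Ss ! j)"
    and "common_alignment ss \<sigma>"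
  shows "objective n Ss \<sigma> + card {x \<in> set (snd \<sigma> ! 0). marked x} = card {i. i < n \<and> marked i}"
proof -
  have "length (ss ! 0) = n" using assms m_pos by simp
  then have sub: "set (snd \<sigma> ! 0) \<subseteq> {..<n}"
    using common_alignment_length(3)[OF assms(4), of 0] assms(1) m_pos by simp
  have "(\<Union>j<length Ss. unaligned n \<sigma> 0 \<inter> Ss ! j) =
      {i. i < n \<and> marked i} - {x \<in> set (snd \<sigma> ! 0). marked x}"
    using marked by (auto simp: unaligned_def aligned_def)
  moreover have "{x \<in> set (snd \<sigma> ! 0). marked x} \<subseteq> {i. i < n \<and> marked i}" using sub by auto
  ultimately show ?thesis
    by (simp add: objective_def card_Diff_subset card_mono)
qed

lemma feasible_cell:
  assumes tab: "\<forall>z<N. good T P z" and len: "length ss = m" "\<forall>s\<in>set ss. length s = n"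
    and A: "\<And>k i. k < m \<Longrightarrow> i < n \<Longrightarrow> A (k * n + i) = ss ! k ! i"
    and feas: "feasible ss n d \<sigma>"
  shows "\<exists>z. N - 1 - d \<le> z \<and> z < N \<and> card {x \<in> set (snd \<sigma> ! 0). marked x} < T z"
proof -
  have ca: "common_alignment ss \<sigma>" and L: "n \<le> d + length (fst \<sigma>)"
    using feas feasible_iff[OF len] by auto
  define L where "L = length (fst \<sigma>)"
  have sub: "set (snd \<sigma> ! k) \<subseteq> {..<n}" if "k < m" for k
    using common_alignment_length(3)[OF ca, of k] len that by simp
  have "card (set (snd \<sigma> ! 0)) = L"
    using common_alignment_length(1,2)[OF ca, of 0] len m_pos by (simp add: distinct_card L_def)
  then have Ln: "L \<le> n" using sub[of 0] m_pos card_mono[of "{..<n}" "set (snd \<sigma> ! 0)"] by simp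
  define z where "z = N - B + L"
  have zN: "z < N" using Ln B_le_N by (simp add: z_def B_def)
  have "N - B = B * (B ^ m - 1)" by (simp add: N_def diff_mult_distrib2)
  moreover have "L < B" using Ln by (simp add: B_def)
  ultimately have zm: "z mod B = L" by (simp add: z_def)
  have dz: "dig (Suc k) z = n" if "k < m" for k
    using digit_top[of L B k m] that Ln by (simp add: z_def N_def B_def)
  have "card {x \<in> set (snd \<sigma> ! 0). marked x} < T z"
    using table_optimal[OF tab len A zN, of "fst \<sigma>" "snd \<sigma>"] ca zm dz sub
    by (auto simp: L_def)
  moreover have "N - 1 - d \<le> z" using L B_le_N by (simp add: z_def L_def B_def)
  ultimately show ?thesis using zN by blast
qed

lemma traced_alignment:
  assumes len: "length ss = m" "\<forall>s\<in>set ss. length s = n"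
    and A: "\<And>k i. k < m \<Longrightarrow> i < n \<Longrightarrow> A (k * n + i) = ss ! k ! i"
    and tr: "traced T z0 z X E" and z: "z mod B = 0" "T z = 1"
    and \<sigma>: "\<sigma> = (map X [0..<z0 mod B], map (\<lambda>k. map (\<lambda>t. E (k * n + t)) [0..<z0 mod B]) [0..<m])"
  shows "common_alignment ss \<sigma>" "card {x \<in> set (snd \<sigma> ! 0). marked x} + 1 = T z0"
proof -
  have tr1: "E (k * n + t) < n" "A (k * n + E (k * n + t)) = X t" if "k < m" "t < z0 mod B" for k t
    using tr z that unfolding traced_def by auto
  have tr2: "E (k * n + t) < E (k * n + u)" if "k < m" "t < u" "u < z0 mod B" for k t u
    using tr z that unfolding traced_def by auto
  have tr3: "1 + (\<Sum>t<z0 mod B. of_bool (marked (E t))) = T z0"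
    using tr z unfolding traced_def by (simp add: atLeast0LessThan)
  have "embeds (map X [0..<z0 mod B]) (map (\<lambda>t. E (k * n + t)) [0..<z0 mod B]) (ss ! k)"
    if "k < m" for k
  proof -
    have "length (ss ! k) = n" using len that by simp
    then show ?thesis using tr1[OF that] tr2[OF that] A[OF that, symmetric]
      by (auto simp: embeds_def sorted_wrt_iff_nth_less)
  qed
  then show "common_alignment ss \<sigma>" using len by (simp add: common_alignment_def \<sigma>)
  have inj: "inj_on E {..<z0 mod B}"
  proof (rule linorder_inj_onI')
    fix i j assume "i \<in> {..<z0 mod B}" "j \<in> {..<z0 mod B}" "i < j"
    then have "E i < E j" using tr2[of 0 i j] m_pos by simp
    then show "E i \<noteq> E j" by simp
  qed
  have "{x \<in> set (snd \<sigma> ! 0). marked x} = E ` {t. t < z0 mod B \<and> marked (E t)}"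
    using m_pos by (auto simp: \<sigma>)
  then have "card {x \<in> set (snd \<sigma> ! 0). marked x} = card {t. t < z0 mod B \<and> marked (E t)}"
    by (simp add: card_image inj_on_subset[OF inj] subset_eq)
  also have "\<dots> = (\<Sum>t<z0 mod B. of_bool (marked (E t)))"
    by (simp add: Int_def)
  finally show "card {x \<in> set (snd \<sigma> ! 0). marked x} + 1 = T z0" using tr3 by simp
qed

lemma run_aligner:
  assumes len: "length ss = m" "\<forall>s\<in>set ss. length s = n"
    and A: "\<And>k i. k < m \<Longrightarrow> i < n \<Longrightarrow> A (k * n + i) = ss ! k ! i"
    and marked: "\<And>i. i < n \<Longrightarrow> marked i \<longleftrightarrow> (\<exists>j<length Ss. i \<in> Ss ! j)"
    and s: "vars s xM = m" "vars s xN = n" "vars s xD = d" "vars s xFound = 0"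
    "arrs s aStrings = A" "arrs s aOffsets = Off"
  shows "run w aligner s (\<lambda>t s'. t \<le> 500 * (m * N) \<and> solution ss n Ss d (output_of m n s'))"
  unfolding aligner_def
proof (rule run_SeqI[OF run_compute_size[OF s]])
  fix t1 :: nat and s1 :: state assume 1: "t1 \<le> 20 + 20 * m \<and> (\<exists>T P. frame T P s1)"
  then obtain T1 P1 where "frame T1 P1 s1" by blast
  then show "run w (fill_table ;; scan ;; trace) s1
      (\<lambda>t s'. t1 + t \<le> 500 * (m * N) \<and> solution ss n Ss d (output_of m n s'))"
  proof (rule run_SeqI[OF run_fill_table])
    fix t2 :: nat and s2 :: state assume 2: "t2 \<le> N * (88 + 64 * m) + 6 \<and> (\<exists>T P. frame T P s2 \<and> (\<forall>z<N. good T P z))"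
    then obtain T P where fr: "frame T P s2" and tab: "\<forall>z<N. good T P z" by blast
    from fr show "run w (scan ;; trace) s2
      (\<lambda>t s'. t1 + (t2 + t) \<le> 500 * (m * N) \<and> solution ss n Ss d (output_of m n s'))"
    proof (rule run_SeqI[OF run_scan])
      fix t3 :: nat and s3 :: state assume 3: "t3 \<le> 20 * N + 20 \<and> frame T P s3 \<and> scanned T N (vars s3 xBest) (vars s3 xNext)"
      then have fr3: "frame T P s3" and sc: "scanned T N (vars s3 xBest) (vars s3 xNext)" by auto
      show "run w trace s3
        (\<lambda>t s'. t1 + (t2 + (t3 + t)) \<le> 500 * (m * N) \<and> solution ss n Ss d (output_of m n s'))"
      proof (rule run_mono[OF run_trace[OF fr3 tab sc]], rule conjI)
        fix t4 :: nat and s' :: state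
        assume 4: "t4 \<le> N * (24 * m + 44) + 20 \<and> (if vars s3 xBest = 0 then vars s' xFound = 0
          else vars s' xFound \<noteq> 0 \<and> vars s' xLen = vars s3 xNext mod B \<and>
            (\<exists>z. z mod B = 0 \<and> T z = 1 \<and> traced T (vars s3 xNext) z (arrs s' aChars) (arrs s' aEmb)))"
        have "1 \<le> N" using B_le_N B_pos by linarith
        then have "1 * N \<le> m * N" "m * 1 \<le> m * N" using m_pos by (auto intro!: mult_le_mono)
        then have "N \<le> m * N" "m \<le> m * N" "1 \<le> m * N" using \<open>1 \<le> N\<close> by linarith+
        moreover have "t1 \<le> 20 + 20 * m" "t2 \<le> 88 * N + 64 * (m * N) + 6" "t3 \<le> 20 * N + 20"
          "t4 \<le> 24 * (m * N) + 44 * N + 20"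
          using 1 2 3 4 by (auto simp: algebra_simps)
        ultimately show "t1 + (t2 + (t3 + t4)) \<le> 500 * (m * N)" by linarith
        have bound: "card {x \<in> set (snd \<tau> ! 0). marked x} < vars s3 xBest"
          if "feasible ss n d \<tau>" for \<tau>
          using feasible_cell[OF tab len A that] sc unfolding scanned_def by (meson less_le_trans)
        show "solution ss n Ss d (output_of m n s')"
        proof (cases "vars s3 xBest = 0")
          case True
          then show ?thesis using 4 bound by (auto simp: solution_def output_of_def)
        next
          case False
          define z0 where "z0 = vars s3 xNext"
          define \<sigma> where "\<sigma> = (map (arrs s' aChars) [0..<z0 mod B],
            map (\<lambda>k. map (\<lambda>t. arrs s' aEmb (k * n + t)) [0..<z0 mod B]) [0..<m])"
          have out: "output_of m n s' = Some \<sigma>"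
            using 4 False by (simp add: output_of_def \<sigma>_def z0_def)
          obtain z where z: "z mod B = 0" "T z = 1" "traced T z0 z (arrs s' aChars) (arrs s' aEmb)"
            using 4 False unfolding z0_def by metis
          have z0: "N - 1 - d \<le> z0" "z0 < N" "T z0 = vars s3 xBest"
            using sc False by (auto simp: scanned_def z0_def)
          note \<sigma> = traced_alignment[OF len A z(3,1,2) \<sigma>_def]
          have NB: "N - B = B * (B ^ m - 1)" by (simp add: N_def diff_mult_distrib2)
          have ge: "N - B \<le> z0" using z0(1) d_le by (simp add: B_def)
          have "z0 = B * (B ^ m - 1) + (z0 - (N - B))" using ge NB by simp
          moreover have "z0 - (N - B) < B" using z0(2) ge B_le_N by linarith
          ultimately have "z0 mod B = z0 - (N - B)" by (metis mod_less mod_mult_self4)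
          then have "n \<le> d + z0 mod B" using z0(1) B_le_N d_le by (simp add: B_def)
          then have feas: "feasible ss n d \<sigma>"
            using feasible_iff[OF len] \<sigma>(1) by (simp add: \<sigma>_def)
          have "\<not> objective n Ss \<tau> < objective n Ss \<sigma>" if "feasible ss n d \<tau>" for \<tau>
            using objective_eq[OF len marked, of \<sigma>] objective_eq[OF len marked, of \<tau>] bound[OF that]
              \<sigma> z0(3) that feasible_iff[OF len] by fastforce
          then show ?thesis using feas by (auto simp: solution_def out is_arg_min_def)
        qed
      qed
    qed
  qed
qed

end

lemma offsets_less_iff:
  assumes "i < n"
  shows "offsets n Ss ! i < offsets n Ss ! Suc i \<longleftrightarrow> (\<exists>j<length Ss. i \<in> Ss ! j)"
proof -
  have "offsets n Ss ! k = length (incidence_lists k Ss)" if "k \<le> n" for k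
    using that by (simp add: offsets_def less_Suc_eq_le del: upt_Suc)
  moreover have "incidence_lists (Suc i) Ss = incidence_lists i Ss @ incidence Ss i"
    by (simp add: incidence_lists_def)
  ultimately have "offsets n Ss ! i < offsets n Ss ! Suc i \<longleftrightarrow> incidence Ss i \<noteq> []"
    using assms by simp
  then show ?thesis by (auto simp: incidence_def filter_empty_conv)
qed

lemma table_size_le_main_term:
  assumes "1 \<le> n" "1 \<le> m"
  shows "m * (n + 1) ^ (m + 1) \<le> 2 * main_term m n" "m * n + n \<le> 2 * main_term m n"
proof -
  have "(n + 1) ^ (m + 1) \<le> (2 * n) ^ (m + 1)" using assms by (intro power_mono) auto
  also have "\<dots> = 2 * 2 ^ m * n ^ (m + 1)" by (simp add: power_mult_distrib)
  finally have "m * (n + 1) ^ (m + 1) \<le> m * (2 * 2 ^ m * n ^ (m + 1))" by (rule mult_left_mono) simp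
  then show "m * (n + 1) ^ (m + 1) \<le> 2 * main_term m n"
    by (simp add: main_term_def mult_ac)
  have "n ^ 1 \<le> n ^ (m + 1)" using assms by (intro power_increasing) auto
  then have "m * n \<le> m * n ^ (m + 1)" by simp
  also have "\<dots> \<le> 2 ^ m * (m * n ^ (m + 1))" by simp
  finally have "m * n \<le> main_term m n" by (simp add: main_term_def mult_ac)
  moreover have "n \<le> m * n" using assms by simp
  ultimately show "m * n + n \<le> 2 * main_term m n" by linarith
qed

theorem theorem6:
  "\<exists>(P :: com) (C :: nat) (p :: nat).
     \<forall>(m :: nat) (n :: nat) (q :: nat) (d :: nat) (ss :: nat list list) (Ss :: nat set list) (w :: nat).
       1 \<le> m \<longrightarrow> length ss = m \<longrightarrow> (\<forall>s\<in>set ss. length s = n) \<longrightarrow>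
       length Ss = q \<longrightarrow> (\<forall>S\<in>set Ss. S \<subseteq> {..<n}) \<longrightarrow> d \<le> n \<longrightarrow>
       word_size_ok C w m n (input_state ss n Ss d) \<longrightarrow>
       (\<exists>t s'. exec w P (input_state ss n Ss d) t s' \<and>
          solution ss n Ss d (output_of m n s') \<and>
          (1 \<le> n \<longrightarrow>
             real t \<le> real C * (2 ^ m * real m * real n ^ (m + 1)) * (1 + log 2 (real n)) ^ p))"
proof (rule exI[of _ aligner], rule exI[of _ 1000], rule exI[of _ 0], intro allI impI)
  fix m n q d :: nat and ss :: "nat list list" and Ss :: "nat set list" and w :: nat
  assume m: "1 \<le> m" and len: "length ss = m" "\<forall>s\<in>set ss. length s = n" and "length Ss = q"
    and "\<forall>S\<in>set Ss. S \<subseteq> {..<n}" and d: "d \<le> n"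
    and word: "word_size_ok 1000 w m n (input_state ss n Ss d)"
  define s where "s = input_state ss n Ss d"
  define A where "A = arrs s aStrings"
  define Off where "Off = arrs s aOffsets"
  have vars: "vars s xM = m" "vars s xN = n" "vars s xD = d" "vars s xFound = 0"
    using len by (simp_all add: s_def input_state_def memory_of_def numeral_eq_Suc)
  have big: "1000 * (1 + main_term m n) \<le> 2 ^ w" and fits: "fits_words w s"
    using word by (simp_all add: word_size_ok_def s_def)
  have mw: "m < 2 ^ w" using fits vars(1) unfolding fits_words_def by metis
  have tabw: "m * n + n < 2 ^ w" "2 * (n + 1) ^ (m + 1) < (2::nat) ^ w"
  proof -
    have "m * n + n < 2 ^ w \<and> 2 * (n + 1) ^ (m + 1) < (2::nat) ^ w"
    proof (cases "n = 0")
      case True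
      then show ?thesis using big by simp
    next
      case False
      then have "1 \<le> n" by simp
      note b = table_size_le_main_term[OF this m]
      have "(n + 1) ^ (m + 1) \<le> m * (n + 1) ^ (m + 1)" using m by simp
      then have "(n + 1) ^ (m + 1) \<le> 2 * main_term m n" using b(1) by (rule order_trans)
      moreover have *: "2 * a < W" if "a \<le> 2 * M" "1000 * (1 + M) \<le> W" for a M W :: nat
        using that by simp
      ultimately have "2 * (m * n + n) < 2 ^ w" "2 * (n + 1) ^ (m + 1) < (2::nat) ^ w"
        using b(2) big by blast+
      then show ?thesis by simp
    qed
    then show "m * n + n < 2 ^ w" "2 * (n + 1) ^ (m + 1) < (2::nat) ^ w" by blast+
  qed
  interpret alignment_table m n d w A Off
    by standard (use m d mw tabw in auto)
  have Ai: "A (k * n + i) = ss ! k ! i" if "k < m" "i < n" for k i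
    using nth_concat_uniform[OF len(2), of k i] that len(1)
    by (simp add: A_def s_def input_state_def memory_of_def)
  have "Off i = offsets n Ss ! i" if "i \<le> n" for i
    using that by (simp add: Off_def s_def input_state_def memory_of_def offsets_def less_Suc_eq_le
        del: upt_Suc)
  then have marked: "marked i \<longleftrightarrow> (\<exists>j<length Ss. i \<in> Ss ! j)" if "i < n" for i
    using offsets_less_iff[OF that] that by (simp add: marked_def)
  obtain t s' where run: "exec w aligner s t s'" "t \<le> 500 * (m * N)"
    "solution ss n Ss d (output_of m n s')"
    using run_aligner[OF len Ai marked vars A_def[symmetric] Off_def[symmetric]]
    unfolding run_def by blast
  have "real t \<le> real 1000 * (2 ^ m * real m * real n ^ (m + 1)) * (1 + log 2 (real n)) ^ 0"
    if "1 \<le> n"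
  proof -
    have "t \<le> 1000 * main_term m n"
      using run(2) table_size_le_main_term(1)[OF that m] by (simp add: N_def B_def)
    then have "real t \<le> real (1000 * main_term m n)" by (rule of_nat_mono)
    then show ?thesis by (simp add: main_term_def)
  qed
  then show "\<exists>t s'. exec w aligner (input_state ss n Ss d) t s' \<and>
      solution ss n Ss d (output_of m n s') \<and>
      (1 \<le> n \<longrightarrow> real t \<le>
         real 1000 * (2 ^ m * real m * real n ^ (m + 1)) * (1 + log 2 (real n)) ^ 0)"
    using run unfolding s_def by blast
qed

end
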